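(* Let $\mathbb{F}$ be a field of characteristic different from $2$. For every $n>0$ ($n$ a power of two) and every integer $\ell>10\log n$, every PC refutation of $BOP^{\vee}_{\ell,n}$ over $\{+1,-1\}$ variables (with coefficients in $\mathbb{F}$) has size $2^{\Omega(n)}$.
   Context: The CNF $BOP^{\vee}_{\ell,n}$ (ordering principle with binary pointers, OR-lifted). Let $n$ be a power of two, $\ell\ge 1$, and $\log$ be base $2$. Variables: $x_{ijl}$ for $i,j\in[n]$, $l\in[\ell]$, and $y_{ja}$ for $j\in[n]$, $a\in[\log n]$. Identify $[n]$ with the set of binary strings of length $\log n$. The expression $(y_j\neq i)$ denotes the clause $\bigvee_{a:\,b_a=0}y_{ja}\vee\bigvee_{a:\,b_a=1}\neg y_{ja}$, where $b_{\log n}\dots b_1$ is the binary representation of $i$. The clauses are: - $(y_j\neq i)\vee\bigvee_{m\in[\ell]}x_{ijm}$ for all $i,j\in[n]$; - $\neg x_{ijl}\vee\neg x_{jkl'}\vee\bigvee_{m\in[\ell]}x_{ikm}$ for all $i,j,k\in[n]$, $l,l'\in[\ell]$; - $\neg x_{ijl}\vee\neg x_{jil'}$ for all $i,j\in[n]$, $l,l'\in[\ell]$. PC over $\{+1,-1\}$: a PC refutation of a set $\Gamma$ of polynomials over $\mathbb{F}$ is a sequence $R_1,\dots,R_s$ with $R_s=1$ in which each $R_r$ is in $\Gamma$, or is an axiom $v^2-1$ for a variable $v$, or equals $\alpha R_p+\beta R_q$ with $p,q<r$, $\alpha,\beta\in\mathbb{F}$, or equals $vR_p$ with $p<r$ and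 $v$ a variable (products are taken modulo $v^2=1$). Its size is the sum over $r$ of the number of monomials of $R_r$. A refutation of a CNF refutes the polynomials encoding its clauses: with $-1$ = true, a clause is encoded as the expanded product of the factors $1+v$ for each literal $v$ and $1-v$ for each literal $\neg v$. *)

theory Defs
  imports
    Complex_Main
    "HOL-Library.Poly_Mapping"
    "HOL-Library.Discrete_Functions"
    "HOL-Computational_Algebra.Computational_Algebra"
begin

datatype 'v literal = Pos 'v | Neg 'v

type_synonym 'v clause = "'v literal set"

datatype bop_var = X nat nat nat | Y nat nat

text \<open>
  Here \<open>[n]\<close> is rendered as \<open>{..<n}\<close>, so that for \<open>n\<close> a power of two its elements are exactly
  the numbers with a binary representation of length \<open>log n = floor_log n\<close>. Bit positions and
  the indices of the OR-lift are counted from 1, so the digit \<open>b\<^sub>a\<close> is \<open>bit i (a - 1)\<close>.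
\<close>

definition bop_vars :: "nat \<Rightarrow> nat \<Rightarrow> bop_var set" where
  "bop_vars l n =
     {X i j m | i j m. i < n \<and> j < n \<and> m \<in> {1..l}} \<union>
     {Y j a | j a. j < n \<and> a \<in> {1..floor_log n}}"

definition neq_clause :: "nat \<Rightarrow> nat \<Rightarrow> nat \<Rightarrow> bop_var clause" where
  "neq_clause n j i =
     {Pos (Y j a) | a. a \<in> {1..floor_log n} \<and> \<not> bit i (a - 1)} \<union>
     {Neg (Y j a) | a. a \<in> {1..floor_log n} \<and> bit i (a - 1)}"

definition or_clause :: "nat \<Rightarrow> nat \<Rightarrow> nat \<Rightarrow> bop_var clause" where
  "or_clause l i j = {Pos (X i j m) | m. m \<in> {1..l}}"

definition BOP_or :: "nat \<Rightarrow> nat \<Rightarrow> bop_var clause set" where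
  "BOP_or l n =
     {neq_clause n j i \<union> or_clause l i j | i j. i < n \<and> j < n} \<union>
     {{Neg (X i j m), Neg (X j k m')} \<union> or_clause l i k | i j k m m'.
        i < n \<and> j < n \<and> k < n \<and> m \<in> {1..l} \<and> m' \<in> {1..l}} \<union>
     {{Neg (X i j m), Neg (X j i m')} | i j m m'.
        i < n \<and> j < n \<and> m \<in> {1..l} \<and> m' \<in> {1..l}}"

text \<open>Multivariate polynomials: finitely supported maps from exponent vectors to coefficients.\<close>

type_synonym ('v, 'f) mpoly = "('v \<Rightarrow>\<^sub>0 nat) \<Rightarrow>\<^sub>0 'f"

definition const_poly :: "'f::field \<Rightarrow> ('v, 'f) mpoly" where
  "const_poly c = Poly_Mapping.single 0 c"

definition var_poly :: "'v \<Rightarrow> ('v, 'f::field) mpoly" where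
  "var_poly v = Poly_Mapping.single (Poly_Mapping.single v 1) 1"

definition num_monomials :: "('v, 'f::field) mpoly \<Rightarrow> nat" where
  "num_monomials p = card (Poly_Mapping.keys p)"

text \<open>The multilinear representative modulo the relations \<open>v\<^sup>2 = 1\<close>.\<close>

definition reduce :: "('v, 'f::field) mpoly \<Rightarrow> ('v, 'f) mpoly" where
  "reduce p = (\<Sum>m\<in>Poly_Mapping.keys p.
     Poly_Mapping.single (Poly_Mapping.map (\<lambda>e. e mod 2) m) (Poly_Mapping.lookup p m))"

text \<open>The value \<open>-1\<close> stands for true, so each factor vanishes iff its literal is true.\<close>

fun literal_poly :: "'v literal \<Rightarrow> ('v, 'f::field) mpoly" where
  "literal_poly (Pos v) = 1 + var_poly v"
| "literal_poly (Neg v) = 1 - var_poly v"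

text \<open>
  The final reduction only matters for clauses that contain both \<open>v\<close> and \<open>\<not> v\<close>: these are
  encoded by 0. Transitivity clauses with coinciding indices can be of this kind.
\<close>

definition clause_poly :: "'v clause \<Rightarrow> ('v, 'f::field) mpoly" where
  "clause_poly C = reduce (\<Prod>x\<in>C. literal_poly x)"

definition pc_refutation ::
  "'v set \<Rightarrow> ('v, 'f::field) mpoly set \<Rightarrow> ('v, 'f) mpoly list \<Rightarrow> bool" where
  "pc_refutation V \<Gamma> R \<longleftrightarrow>
     R \<noteq> [] \<and> last R = 1 \<and>
     (\<forall>r<length R.
        R ! r \<in> \<Gamma> \<or>
        (\<exists>v\<in>V. R ! r = var_poly v ^ 2 - 1) \<or>
        (\<exists>p<r. \<exists>q<r. \<exists>\<alpha> \<beta>. R ! r = const_poly \<alpha> * R ! p + const_poly \<beta> * R ! q) \<or>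
        (\<exists>p<r. \<exists>v\<in>V. R ! r = reduce (var_poly v * R ! p)))"

definition pc_size :: "('v, 'f::field) mpoly list \<Rightarrow> nat" where
  "pc_size R = (\<Sum>p\<leftarrow>R. num_monomials p)"

end

theory Submission
  imports Defs "HOL-Library.FuncSet"
begin

text \<open>
  A random set \<open>S\<close> of elements is kept, and the other elements form an antichain above \<open>S\<close> and point
  into \<open>S\<close>. The variables \<open>x\<^bsub>ijm\<^esub>\<close> with \<open>i\<close> in \<open>S\<close>, \<open>j\<close> outside and \<open>m \<ge> 2\<close>, and for each \<open>j\<close> outside
  \<open>S\<close> some of the bits of \<open>y\<^sub>j\<close>, are split: they take all values, hence terms whose quotient contains
  a split variable do not interact. With high probability the quotient of any two
  monomials of the refutation contains a split variable or has few heads, that is, indices \<open>j\<close> in \<open>S\<close>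
  such that a variable \<open>x\<^bsub>ijm\<^esub>\<close> or \<open>y\<^bsub>ja\<^esub>\<close> occurs in it. A monomial may still contain many \<open>x\<^bsub>ijm\<^esub>\<close> with
  the same \<open>j\<close>. To cope with these, a random character \<open>\<sigma>\<^bsub>ij\<^esub>\<close> of each block \<open>x\<^bsub>ij1\<^esub>, \<dots>, x\<^bsub>ijl\<^esub>\<close> is
  reserved; the monomials of the refutation agree with \<open>\<sigma>\<close> on few blocks, and a monomial is said to
  mention its heads (relative to a base monomial) and the \<open>i\<close> of its reserved blocks only.

  A polynomial is null if it is a sum of polynomials each of which mentions a small set \<open>A\<close> and
  vanishes on all assignments that satisfy the axioms inside \<open>A\<close>. If all monomials of a null
  polynomial mention at most \<open>d\<close> elements, then sets \<open>A\<close> of size \<open>d\<close> suffice: a superfluous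
  element \<open>k\<close> is projected away by putting it below the rest of \<open>A\<close> and letting it point outside \<open>A\<close>.
  The blocks \<open>x\<^bsub>kj\<^esub>\<close> are then true, and on true blocks the reserved character is minus the sum of all the
  others, which do not mention \<open>k\<close>. Therefore the null polynomials are closed under the rules, but \<open>1\<close>
  is not null.
\<close>

section \<open>Characters and polynomial functions\<close>

definition symdiff :: "'v set \<Rightarrow> 'v set \<Rightarrow> 'v set" (infixl "\<triangle>" 65) where
  "M \<triangle> N = sym_diff M N"

lemma in_symdiff [simp]: "x \<in> M \<triangle> N \<longleftrightarrow> (x \<in> M) \<noteq> (x \<in> N)"
  by (auto simp: symdiff_def)

lemma symdiff_assoc: "(A \<triangle> B) \<triangle> C = A \<triangle> (B \<triangle> C)"
  by auto

lemma symdiff_cancel [simp]: "(A \<triangle> B) \<triangle> B = A" "B \<triangle> (B \<triangle> A) = A" "A \<triangle> A = {}"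
    "A \<triangle> {} = A" "{} \<triangle> A = A"
  by auto

lemma finite_symdiff [simp]: "finite A \<Longrightarrow> finite B \<Longrightarrow> finite (A \<triangle> B)"
  by (simp add: symdiff_def)

lemma symdiff_subset: "A \<subseteq> V \<Longrightarrow> B \<subseteq> V \<Longrightarrow> A \<triangle> B \<subseteq> V"
  by auto

lemma bij_symdiff: "m \<subseteq> V \<Longrightarrow> bij_betw (\<lambda>M. M \<triangle> m) (Pow V) (Pow V)"
  by (rule bij_betw_byWitness[where f' = "\<lambda>M. M \<triangle> m"]) auto

text \<open>A set \<open>M\<close> of variables stands for the multilinear monomial in these
  variables. An assignment \<open>a\<close> is the set of its true variables, those with value
  -1.\<close>

definition chi :: "'v set \<Rightarrow> 'v set \<Rightarrow> 'f::field" where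
  "chi M a = (\<Prod>v\<in>M. if v \<in> a then - 1 else 1)"

lemma chi_empty [simp]: "chi {} a = 1" "chi M {} = 1"
  by (simp_all add: chi_def)

lemma chi_insert: "finite M \<Longrightarrow> v \<notin> M \<Longrightarrow> chi (insert v M) a = (if v \<in> a then - 1 else 1) * chi M a"
  by (simp add: chi_def)

lemma chi_Un: "finite M \<Longrightarrow> finite N \<Longrightarrow> M \<inter> N = {} \<Longrightarrow> chi (M \<union> N) a = chi M a * chi N a"
  by (simp add: chi_def prod.union_disjoint)

lemma chi_square [simp]: "chi M a * chi M a = 1"
  by (simp add: chi_def flip: prod.distrib) (rule prod.neutral, auto)

lemma chi_nonzero [simp]: "chi M a \<noteq> 0"
  using chi_square[of M a] by (metis mult_zero_left zero_neq_one)

lemma chi_symdiff: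
  assumes "finite M" "finite N"
  shows "chi (M \<triangle> N) a = chi M a * chi N a"
proof -
  have *: "chi M a = (chi (M - N) a * chi (M \<inter> N) a :: 'b)" if "finite M" for M N :: "'a set"
    by (subst chi_Un[symmetric]) (use that in \<open>auto simp: Un_Diff_Int\<close>)
  have "chi M a * chi N a = (chi (M - N) a * chi (M \<inter> N) a) * (chi (N - M) a * chi (M \<inter> N) a :: 'b)"
    using *[OF assms(1), of N] *[OF assms(2), of M] by (simp add: Int_commute)
  also have "\<dots> = chi (M - N) a * chi (N - M) a * (chi (M \<inter> N) a * chi (M \<inter> N) a)"
    by (simp only: mult_ac)
  also have "\<dots> = chi (M - N) a * chi (N - M) a"
    by simp
  also have "\<dots> = chi (M \<triangle> N) a"
    unfolding symdiff_def using assms by (subst chi_Un) auto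
  finally show ?thesis ..
qed

lemma chi_cong: "M \<inter> a = M \<inter> b \<Longrightarrow> chi M a = chi M b"
  unfolding chi_def by (rule prod.cong) auto

lemma chi_Int: "finite M \<Longrightarrow> chi M a = chi (M \<inter> a) a"
  unfolding chi_def by (subst prod.inter_restrict) (auto intro: prod.cong)

lemma chi_swap: "finite M \<Longrightarrow> finite a \<Longrightarrow> chi M a = chi a M"
  by (subst chi_Int, simp, subst (2) chi_Int, simp, simp add: Int_commute)
     (auto simp: chi_def intro: prod.cong)

lemma sum_Pow_insert:
  assumes "finite B" "x \<notin> B"
  shows "(\<Sum>P\<in>Pow (insert x B). g P) = (\<Sum>P\<in>Pow B. g P) + (\<Sum>P\<in>Pow B. g (insert x P))"
proof -
  have "inj_on (insert x) (Pow B)"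
    using assms by (intro inj_onI) (auto simp: insert_eq_iff)
  moreover have "Pow B \<inter> insert x ` Pow B = {}"
    using assms by auto
  ultimately show ?thesis
    using assms by (simp add: Pow_insert sum.union_disjoint sum.reindex)
qed

lemma sum_Pow_split:
  assumes "finite V" "B \<subseteq> V"
  shows "(\<Sum>M\<in>Pow V. g M) = (\<Sum>N\<in>Pow (V - B). \<Sum>P\<in>Pow B. g (N \<union> P))"
proof -
  have "bij_betw (\<lambda>(N, P). N \<union> P) (Pow (V - B) \<times> Pow B) (Pow V)"
    by (rule bij_betw_byWitness[where f' = "\<lambda>M. (M - B, M \<inter> B)"]) (use assms in auto)
  then have "(\<Sum>M\<in>Pow V. g M) = (\<Sum>(N, P)\<in>Pow (V - B) \<times> Pow B. g (N \<union> P))"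
    by (subst sum.reindex_bij_betw[symmetric, of "\<lambda>(N, P). N \<union> P"]) (simp_all add: split_def)
  then show ?thesis
    by (simp add: sum.cartesian_product)
qed

text \<open>Toggling a fixed \<open>x \<in> W\<close> in \<open>P\<close> changes the sign of the
  character, so the terms cancel in pairs.\<close>

lemma sum_chi_right:
  assumes "finite B" "W \<subseteq> B"
  shows "(\<Sum>P\<in>Pow B. chi W P) = (if W = {} then 2 ^ card B else 0 :: 'b::field)"
proof (cases "W = {}")
  case True
  then show ?thesis using assms by (simp add: card_Pow)
next
  case False
  then obtain x where x: "x \<in> W" by auto
  define B' where "B' = B - {x}"
  have fW: "finite W" using assms finite_subset by auto
  have B: "B = insert x B'" "x \<notin> B'" "finite B'"
    using assms x by (auto simp: B'_def)
  have "chi W (insert x P) = - (chi W P :: 'b)" if "P \<in> Pow B'" for P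
  proof -
    have W: "chi W = chi (insert x (W - {x}))" using x by (simp add: insert_absorb)
    have "chi (W - {x}) (insert x P) = (chi (W - {x}) P :: 'b)"
      by (rule chi_cong) auto
    then show ?thesis
      using fW unfolding W by (subst (1 2) chi_insert) (use that B in auto)
  qed
  then have "(\<Sum>P\<in>Pow B. chi W P) = (0::'b)"
    using B by (simp add: sum_Pow_insert sum_negf)
  then show ?thesis using False by simp
qed

lemma sum_chi_left:
  assumes "finite B" "a \<inter> B \<noteq> {}"
  shows "(\<Sum>P\<in>Pow B. chi P a) = (0 :: 'b::field)"
proof -
  have "chi P a = (chi (a \<inter> B) P :: 'b)" if "P \<in> Pow B" for P
  proof -
    have fP: "finite P" using that assms(1) finite_subset by auto
    have "chi P a = (chi P (a \<inter> B) :: 'b)"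
      by (rule chi_cong) (use that in auto)
    also have "\<dots> = chi (a \<inter> B) P"
      by (rule chi_swap) (use assms fP in auto)
    finally show ?thesis .
  qed
  then have "(\<Sum>P\<in>Pow B. chi P a) = (\<Sum>P\<in>Pow B. chi (a \<inter> B) P :: 'b)"
    by (rule sum.cong[OF refl])
  then show ?thesis using sum_chi_right[of B "a \<inter> B", where 'b = 'b] assms by simp
qed

section \<open>Evaluation of coefficient functions, and Fourier inversion over a block of
  variables\<close>

definition ev :: "'v set \<Rightarrow> ('v set \<Rightarrow> 'f::field) \<Rightarrow> 'v set \<Rightarrow> 'f" where
  "ev V f a = (\<Sum>M\<in>Pow V. f M * chi M a)"

lemma ev_add: "ev V (\<lambda>M. f M + g M) a = ev V f a + ev V g a"
  by (simp add: ev_def algebra_simps sum.distrib)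

lemma ev_diff: "ev V (\<lambda>M. f M - g M) a = ev V f a - ev V g a"
  by (simp add: ev_def algebra_simps sum_subtractf)

lemma ev_cmult: "ev V (\<lambda>M. c * f M) a = c * ev V f a"
  by (simp add: ev_def sum_distrib_left mult.assoc)

lemma ev_shift:
  assumes "finite V" "m \<subseteq> V"
  shows "ev V (\<lambda>M. f (M \<triangle> m)) a = chi m a * ev V f a"
proof -
  have "ev V (\<lambda>M. f (M \<triangle> m)) a = (\<Sum>M\<in>Pow V. f (M \<triangle> m) * chi ((M \<triangle> m) \<triangle> m) a)"
    by (simp add: ev_def)
  also have "\<dots> = (\<Sum>N\<in>Pow V. f N * chi (N \<triangle> m) a)"
    using sum.reindex_bij_betw[OF bij_symdiff[OF assms(2)], of "\<lambda>N. f N * chi (N \<triangle> m) a"] .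
  also have "\<dots> = (\<Sum>N\<in>Pow V. chi m a * (f N * chi N a))"
    using assms by (intro sum.cong) (auto simp: chi_symdiff finite_subset)
  finally show ?thesis by (simp add: ev_def sum_distrib_left)
qed

text \<open>Fourier inversion over the patterns \<open>P\<close> of the block \<open>B\<close>:
  orthogonality of characters leaves the terms of \<open>f\<close> whose restriction to
  \<open>B\<close> is \<open>W\<close>, each weighted by \<open>2 ^ card B\<close>.\<close>

lemma ev_twist:
  assumes V: "finite V" "B \<subseteq> V" and W: "W \<subseteq> B"
  shows "(\<Sum>P\<in>Pow B. chi W P * ev V f ((a - B) \<union> P)) =
         2 ^ card B * (\<Sum>M\<in>Pow V. if M \<inter> B = W then f M * chi (M - B) a else 0)"
proof -
  have fB: "finite B" using V finite_subset by auto
  have chi1: "chi W P * chi M ((a - B) \<union> P) = chi (M - B) a * (chi (W \<triangle> (M \<inter> B)) P :: 'b)"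
    if "P \<subseteq> B" "M \<subseteq> V" for M P
  proof -
    have fM: "finite M" "finite W"
      using that V W fB by (auto intro: finite_subset)
    have "chi M ((a - B) \<union> P) = (chi (M - B) ((a - B) \<union> P) * chi (M \<inter> B) ((a - B) \<union> P) :: 'b)"
      by (subst chi_Un[symmetric]) (use fM in \<open>auto simp: Un_Diff_Int\<close>)
    also have "chi (M - B) ((a - B) \<union> P) = (chi (M - B) a :: 'b)"
      by (rule chi_cong) (use that in auto)
    also have "chi (M \<inter> B) ((a - B) \<union> P) = (chi (M \<inter> B) P :: 'b)"
      by (rule chi_cong) (use that in auto)
    finally show ?thesis using fM by (simp add: chi_symdiff mult_ac)
  qed
  have "(\<Sum>P\<in>Pow B. chi W P * ev V f ((a - B) \<union> P))
      = (\<Sum>P\<in>Pow B. \<Sum>M\<in>Pow V. f M * chi (M - B) a * chi (W \<triangle> (M \<inter> B)) P)"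
    unfolding ev_def sum_distrib_left
  proof (intro sum.cong refl)
    fix P M assume "P \<in> Pow B" "M \<in> Pow V"
    then show "chi W P * (f M * chi M (a - B \<union> P)) = f M * chi (M - B) a * chi (W \<triangle> (M \<inter> B)) P"
      using chi1[of P M] by (metis (no_types, lifting) PowD mult.assoc mult.left_commute)
  qed
  also have "\<dots> = (\<Sum>M\<in>Pow V. \<Sum>P\<in>Pow B. f M * chi (M - B) a * chi (W \<triangle> (M \<inter> B)) P)"
    by (rule sum.swap)
  also have "\<dots> = (\<Sum>M\<in>Pow V. f M * chi (M - B) a * (if M \<inter> B = W then 2 ^ card B else 0))"
  proof (rule sum.cong[OF refl])
    fix M assume "M \<in> Pow V"
    have "W \<triangle> (M \<inter> B) = {} \<longleftrightarrow> M \<inter> B = W" by (auto simp: symdiff_def)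
    moreover have "W \<triangle> (M \<inter> B) \<subseteq> B" using W by auto
    ultimately show "(\<Sum>P\<in>Pow B. f M * chi (M - B) a * chi (W \<triangle> (M \<inter> B)) P)
        = f M * chi (M - B) a * (if M \<inter> B = W then 2 ^ card B else 0)"
      using sum_chi_right[OF fB, of "W \<triangle> (M \<inter> B)", where 'b = 'b] by (simp flip: sum_distrib_left)
  qed
  also have "\<dots> = 2 ^ card B * (\<Sum>M\<in>Pow V. if M \<inter> B = W then f M * chi (M - B) a else 0)"
    unfolding sum_distrib_left by (intro sum.cong) auto
  finally show ?thesis .
qed

text \<open>
  On nonempty patterns of the block \<open>B\<close> the characters of \<open>B\<close> sum to zero, so the character \<open>\<tau>\<close>
  may be replaced by minus the sum of all the others.
\<close>

definition avoid :: "'v set \<Rightarrow> 'v set \<Rightarrow> ('v set \<Rightarrow> 'f::field) \<Rightarrow> 'v set \<Rightarrow> 'f" where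
  "avoid B \<tau> f M = (if M \<inter> B = \<tau> then 0 else f M - f ((M - B) \<union> \<tau>))"

lemma ev_avoid:
  assumes V: "finite V" "B \<subseteq> V" and \<tau>: "\<tau> \<subseteq> B" and a: "a \<inter> B \<noteq> {}"
  shows "ev V (avoid B \<tau> f) a = ev V f a"
proof -
  have fB: "finite B" using V finite_subset by auto
  \<comment> \<open>The correction \<open>f ((M - B) \<union> \<tau>)\<close> depends on
    \<open>M\<close> only outside \<open>B\<close>, so the characters of \<open>B\<close> factor out
    as \<open>\<Sum>P\<in>Pow B. chi P a\<close>, which is zero because \<open>a\<close> meets
    \<open>B\<close>.\<close>
  have "ev V f a - ev V (avoid B \<tau> f) a = (\<Sum>M\<in>Pow V. f ((M - B) \<union> \<tau>) * chi M a)"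
    unfolding ev_def sum_subtractf[symmetric]
  proof (intro sum.cong refl)
    fix M
    have "(M - B) \<union> \<tau> = M" if "M \<inter> B = \<tau>" using that by auto
    then show "f M * chi M a - avoid B \<tau> f M * chi M a = f ((M - B) \<union> \<tau>) * chi M a"
      by (auto simp: avoid_def algebra_simps)
  qed
  also have "\<dots> = (\<Sum>N\<in>Pow (V - B). \<Sum>P\<in>Pow B. f ((N \<union> P - B) \<union> \<tau>) * chi (N \<union> P) a)"
    by (rule sum_Pow_split[OF V])
  also have "\<dots> = (\<Sum>N\<in>Pow (V - B). \<Sum>P\<in>Pow B. f (N \<union> \<tau>) * chi N a * chi P a)"
  proof (intro sum.cong refl)
    fix N P assume NP: "N \<in> Pow (V - B)" "P \<in> Pow B"
    then have "N \<union> P - B = N" by auto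
    moreover have "chi (N \<union> P) a = (chi N a * chi P a :: 'b)"
      by (rule chi_Un) (use NP V fB finite_subset in blast)+
    ultimately show "f ((N \<union> P - B) \<union> \<tau>) * chi (N \<union> P) a = f (N \<union> \<tau>) * chi N a * chi P a"
      by simp
  qed
  also have "\<dots> = 0"
    using sum_chi_left[OF fB a, where 'b = 'b] by (simp add: sum_distrib_left[symmetric] del: mult_eq_0_iff)
  finally show ?thesis by simp
qed

text \<open>Without monomials of pattern \<open>\<tau>\<close> on \<open>B\<close>, the Fourier
  coefficient at \<open>\<tau>\<close> over all patterns of \<open>B\<close> is zero. The nonempty
  patterns contribute nothing, which leaves only the empty one, with weight 1.\<close>

lemma ev_zero_on_empty_block:
  assumes V: "finite V" "B \<subseteq> V" and \<tau>: "\<tau> \<subseteq> B"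
    and supp: "\<And>M. M \<subseteq> V \<Longrightarrow> f M \<noteq> 0 \<Longrightarrow> M \<inter> B \<noteq> \<tau>"
    and zero: "\<And>P. P \<subseteq> B \<Longrightarrow> P \<noteq> {} \<Longrightarrow> ev V f ((a - B) \<union> P) = 0"
  shows "ev V f (a - B) = 0"
proof -
  have fB: "finite B" using V finite_subset by auto
  have "(\<Sum>P\<in>Pow B. chi \<tau> P * ev V f ((a - B) \<union> P)) = 0"
    unfolding ev_twist[OF V \<tau>] using supp by (intro mult_eq_0_iff[THEN iffD2] disjI2 sum.neutral) auto
  also have "(\<Sum>P\<in>Pow B. chi \<tau> P * ev V f ((a - B) \<union> P)) = (\<Sum>P\<in>{{}}. chi \<tau> P * ev V f ((a - B) \<union> P))"
    by (rule sum.mono_neutral_right) (use fB zero in auto)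
  finally show ?thesis by simp
qed

text \<open>The coefficients after the variables of \<open>B\<close> are assigned by
  \<open>h\<close>: monomials that differ only inside \<open>B\<close> are merged, each with the
  sign of its part in \<open>B\<close>.\<close>

definition fixvars :: "'v set \<Rightarrow> 'v set \<Rightarrow> ('v set \<Rightarrow> 'f::field) \<Rightarrow> 'v set \<Rightarrow> 'f" where
  "fixvars B h f M = (if M \<inter> B = {} then (\<Sum>W\<in>Pow B. f (M \<union> W) * chi W h) else 0)"

lemma ev_fixvars:
  assumes V: "finite V" "B \<subseteq> V" and h: "h \<subseteq> B"
  shows "ev V (fixvars B h f) a = ev V f ((a - B) \<union> h)"
proof -
  have fB: "finite B" using V finite_subset by auto
  have "ev V (fixvars B h f) a = (\<Sum>N\<in>Pow (V - B). fixvars B h f N * chi N a)"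
    unfolding ev_def
    by (rule sum.mono_neutral_right) (use V in \<open>auto simp: fixvars_def\<close>)
  also have "\<dots> = (\<Sum>N\<in>Pow (V - B). \<Sum>W\<in>Pow B. f (N \<union> W) * chi (N \<union> W) ((a - B) \<union> h))"
  proof (rule sum.cong[OF refl])
    fix N assume N: "N \<in> Pow (V - B)"
    have *: "chi N a * chi W h = (chi (N \<union> W) ((a - B) \<union> h) :: 'b)" if "W \<in> Pow B" for W
    proof -
      have "chi (N \<union> W) ((a - B) \<union> h) = (chi N ((a - B) \<union> h) * chi W ((a - B) \<union> h) :: 'b)"
        by (rule chi_Un) (use N that V fB finite_subset in blast)+
      moreover have "chi N ((a - B) \<union> h) = (chi N a :: 'b)"
        by (rule chi_cong) (use N h in auto)
      moreover have "chi W ((a - B) \<union> h) = (chi W h :: 'b)"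
        by (rule chi_cong) (use that h in auto)
      ultimately show ?thesis by simp
    qed
    have "fixvars B h f N = (\<Sum>W\<in>Pow B. f (N \<union> W) * chi W h)"
      using N by (auto simp: fixvars_def)
    then have "fixvars B h f N * chi N a = (\<Sum>W\<in>Pow B. f (N \<union> W) * (chi N a * chi W h))"
      by (simp add: sum_distrib_right sum_distrib_left mult_ac)
    then show "fixvars B h f N * chi N a = (\<Sum>W\<in>Pow B. f (N \<union> W) * chi (N \<union> W) ((a - B) \<union> h))"
      using * by simp
  qed
  also have "\<dots> = ev V f ((a - B) \<union> h)"
    unfolding ev_def by (rule sum_Pow_split[OF V, symmetric])
  finally show ?thesis .
qed

section \<open>Null polynomials\<close>

text \<open>\<open>T\<close> holds the split variables, \<open>Bl i j\<close> the block for the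
  relation of \<open>i\<close> to \<open>j\<close>, \<open>Yv j\<close> the pointer of
  \<open>j\<close>, and \<open>Sol A\<close> the assignments that satisfy the axioms inside
  \<open>A\<close>. \<open>Sol_extend\<close> makes an element \<open>k\<close> removable: if
  \<open>k\<close> is below the rest of \<open>A\<close>, one choice \<open>h\<close> for the
  variables with head \<open>k\<close>, the same for all assignments, turns a member of
  \<open>Sol (A - {k})\<close> into one of \<open>Sol A\<close>. \<open>Sol_block\<close> frees the
  blocks from outside \<open>A\<close> into \<open>A\<close>, and \<open>Sol_T\<close> frees the
  split variables.\<close>

locale local_worlds =
  fixes V T :: "'v set" and S :: "'s set" and Bl :: "'s \<Rightarrow> 's \<Rightarrow> 'v set"
    and Yv :: "'s \<Rightarrow> 'v set" and Sol :: "'s set \<Rightarrow> 'v set set"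
  assumes finV: "finite V" and finS: "finite S"
    and Bl_V: "i \<in> S \<Longrightarrow> j \<in> S \<Longrightarrow> Bl i j \<subseteq> V - T"
    and Yv_V: "j \<in> S \<Longrightarrow> Yv j \<subseteq> V - T"
    and Bl_disjoint: "(i, j) \<noteq> (i', j') \<Longrightarrow> Bl i j \<inter> Bl i' j' = {}"
    and Yv_disjoint: "j \<noteq> j' \<Longrightarrow> Yv j \<inter> Yv j' = {}"
    and Yv_Bl_disjoint: "Yv j \<inter> Bl i' j' = {}"
    and Sol_antimono: "A \<subseteq> B \<Longrightarrow> Sol B \<subseteq> Sol A"
    and Sol_block: "A \<subseteq> S \<Longrightarrow> k \<in> S - A \<Longrightarrow> j \<in> A \<Longrightarrow> a \<in> Sol A \<Longrightarrow> P \<subseteq> Bl k j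
          \<Longrightarrow> (a - Bl k j) \<union> P \<in> Sol A"
    and Sol_extend: "A \<subseteq> S \<Longrightarrow> k \<in> A \<Longrightarrow> card A < card S \<Longrightarrow>
          \<exists>h. h \<subseteq> Yv k \<union> (\<Union>i\<in>S - {k}. Bl i k) \<and>
            (\<forall>a\<in>Sol (A - {k}). (\<forall>j\<in>A - {k}. a \<inter> Bl k j \<noteq> {}) \<longrightarrow>
               (a - (Yv k \<union> (\<Union>i\<in>S - {k}. Bl i k))) \<union> h \<in> Sol A)"
    and Sol_nonempty: "Sol {} \<noteq> {}"
    and T_V: "T \<subseteq> V"
    and Sol_T: "a \<in> Sol A \<Longrightarrow> P \<subseteq> T \<Longrightarrow> (a - T) \<union> P \<in> Sol A"
begin

definition Hd :: "'s \<Rightarrow> 'v set" where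
  "Hd j = Yv j \<union> (\<Union>i\<in>S - {j}. Bl i j)"

definition heads :: "'v set \<Rightarrow> 's set" where
  "heads M = {j \<in> S. M \<inter> Hd j \<noteq> {}}"

text \<open>Only an exact match with the reserved character counts: any other pattern of a block can
  be kept when its tail is forgotten.\<close>

definition tails :: "('s \<Rightarrow> 's \<Rightarrow> 'v set) \<Rightarrow> 'v set \<Rightarrow> 's set" where
  "tails \<tau> M = {i \<in> S. \<exists>j\<in>S - {i}. M \<inter> Bl i j = \<tau> i j}"

text \<open>The elements of \<open>tails \<tau> {}\<close> have an empty reserved character in some
  block. They cannot be projected away by replacing characters, so they count as mentioned in every
  monomial.\<close>

definition mention :: "('s \<Rightarrow> 's \<Rightarrow> 'v set) \<Rightarrow> 'v set \<Rightarrow> 's set" where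
  "mention \<tau> M = tails \<tau> {} \<union> heads M \<union> tails \<tau> M"

definition ideal :: "('s \<Rightarrow> 's \<Rightarrow> 'v set) \<Rightarrow> 's set \<Rightarrow> ('v set \<Rightarrow> 'f::field) set" where
  "ideal \<tau> A = {q. (\<forall>M. q M \<noteq> 0 \<longrightarrow> M \<subseteq> V - T \<and> mention \<tau> M \<subseteq> A) \<and> (\<forall>a\<in>Sol A. ev V q a = 0)}"

inductive_set null_polys :: "('s \<Rightarrow> 's \<Rightarrow> 'v set) \<Rightarrow> nat \<Rightarrow> ('v set \<Rightarrow> 'f::field) set"
  for \<tau> d where
  zero: "(\<lambda>_. 0) \<in> null_polys \<tau> d"
| step: "q \<in> ideal \<tau> A \<Longrightarrow> A \<subseteq> S \<Longrightarrow> card A \<le> d \<Longrightarrow> f \<in> null_polys \<tau> d \<Longrightarrow> (\<lambda>M. q M + f M) \<in> null_polys \<tau> d"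

lemma Hd_V: "j \<in> S \<Longrightarrow> Hd j \<subseteq> V - T"
  using Bl_V Yv_V by (fastforce simp: Hd_def)

lemma Bl_Hd: "i \<in> S \<Longrightarrow> i \<noteq> j \<Longrightarrow> Bl i j \<subseteq> Hd j"
  by (auto simp: Hd_def)

lemma Bl_Hd_disjoint: "j \<noteq> k \<Longrightarrow> Bl i j \<inter> Hd k = {}"
  using Bl_disjoint Yv_Bl_disjoint unfolding Hd_def by fast

lemma ideal_mono: "A \<subseteq> B \<Longrightarrow> q \<in> ideal \<tau> A \<Longrightarrow> q \<in> ideal \<tau> B"
  using Sol_antimono[of A B] by (fastforce simp: ideal_def)

lemma ideal_add: "q \<in> ideal \<tau> A \<Longrightarrow> r \<in> ideal \<tau> A \<Longrightarrow> (\<lambda>M. q M + r M) \<in> ideal \<tau> A"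
  unfolding ideal_def mem_Collect_eq ev_add by (metis add_0)

lemma ideal_diff: "q \<in> ideal \<tau> A \<Longrightarrow> r \<in> ideal \<tau> A \<Longrightarrow> (\<lambda>M. q M - r M) \<in> ideal \<tau> A"
  unfolding ideal_def mem_Collect_eq ev_diff by (metis diff_0_right diff_self)

lemma ideal_cmult: "q \<in> ideal \<tau> A \<Longrightarrow> (\<lambda>M. c * q M) \<in> ideal \<tau> A"
  unfolding ideal_def mem_Collect_eq ev_cmult by simp

lemma ideal_zero: "(\<lambda>_. 0) \<in> ideal \<tau> A"
  by (simp add: ideal_def ev_def)

lemma null_ideal: "q \<in> ideal \<tau> A \<Longrightarrow> A \<subseteq> S \<Longrightarrow> card A \<le> d \<Longrightarrow> q \<in> null_polys \<tau> d"
  using null_polys.step[OF _ _ _ null_polys.zero] by fastforce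

lemma null_add: "f \<in> null_polys \<tau> d \<Longrightarrow> g \<in> null_polys \<tau> d \<Longrightarrow> (\<lambda>M. f M + g M) \<in> null_polys \<tau> d"
proof (induction rule: null_polys.induct)
  case (step q A f)
  then have "(\<lambda>M. q M + (f M + g M)) \<in> null_polys \<tau> d" by (intro null_polys.step[of q]) auto
  then show ?case by (simp add: add.assoc)
qed simp

lemma null_cmult: "f \<in> null_polys \<tau> d \<Longrightarrow> (\<lambda>M. c * f M) \<in> null_polys \<tau> d"
proof (induction rule: null_polys.induct)
  case zero
  then show ?case using null_polys.zero by simp
next
  case (step q A f)
  then show ?case using null_polys.step[OF ideal_cmult[of q \<tau> A c]] by (simp add: distrib_left)
qed

lemma null_sum: "finite I \<Longrightarrow> (\<And>i. i \<in> I \<Longrightarrow> f i \<in> null_polys \<tau> d) \<Longrightarrow> (\<lambda>M. \<Sum>i\<in>I. f i M) \<in> null_polys \<tau> d"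
proof (induction rule: finite_induct)
  case empty
  then show ?case using null_polys.zero by simp
next
  case (insert x F)
  then show ?case using null_add[of "f x" \<tau> d "\<lambda>M. \<Sum>i\<in>F. f i M"] by simp
qed

text \<open>Summands with the same set \<open>A\<close> can be added inside
  \<open>ideal \<tau> A\<close>, so one summand for each small set is enough;
  \<open>trim_step\<close> compares summands indexed in this way.\<close>

lemma null_repr:
  assumes "f \<in> null_polys \<tau> d"
  shows "\<exists>q. (\<forall>A. q A \<in> ideal \<tau> A) \<and> f = (\<lambda>M. \<Sum>A\<in>{A. A \<subseteq> S \<and> card A \<le> d}. q A M)"
  using assms
proof (induction rule: null_polys.induct)
  case zero
  show ?case by (intro exI[of _ "\<lambda>_ _. 0"]) (simp add: ideal_zero)
next
  case (step r B f)
  then obtain q where q: "\<forall>A. q A \<in> ideal \<tau> A" "f = (\<lambda>M. \<Sum>A\<in>{A. A \<subseteq> S \<and> card A \<le> d}. q A M)"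
    by auto
  let ?q = "q(B := (\<lambda>M. r M + q B M))"
  have fin: "finite {A. A \<subseteq> S \<and> card A \<le> d}" using finS by simp
  have B: "B \<in> {A. A \<subseteq> S \<and> card A \<le> d}" using step by simp
  have "(\<lambda>M. r M + f M) = (\<lambda>M. \<Sum>A\<in>{A. A \<subseteq> S \<and> card A \<le> d}. ?q A M)"
  proof
    fix M
    have "(\<Sum>A\<in>{A. A \<subseteq> S \<and> card A \<le> d}. ?q A M) = (r M + q B M) + (\<Sum>A\<in>{A. A \<subseteq> S \<and> card A \<le> d} - {B}. q A M)"
      by (subst sum.remove[OF fin B]) simp
    then show "r M + f M = (\<Sum>A\<in>{A. A \<subseteq> S \<and> card A \<le> d}. ?q A M)"
      unfolding q(2) by (subst sum.remove[OF fin B]) simp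
  qed
  moreover have "\<forall>A. ?q A \<in> ideal \<tau> A"
    using q(1) step(1) by (auto intro: ideal_add)
  ultimately show ?case by blast
qed

section \<open>Projecting an element away from the mentioned sets\<close>

definition avoids :: "('s \<Rightarrow> 's \<Rightarrow> 'v set) \<Rightarrow> 's \<Rightarrow> 's list \<Rightarrow> ('v set \<Rightarrow> 'f::field) \<Rightarrow> 'v set \<Rightarrow> 'f" where
  "avoids \<tau> k js f = foldr (\<lambda>j. avoid (Bl k j) (\<tau> k j)) js f"

context
  fixes \<tau> :: "'s \<Rightarrow> 's \<Rightarrow> 'v set"
  assumes \<tau>: "\<And>i j. \<tau> i j \<subseteq> Bl i j"
begin

text \<open>A term \<open>M\<close> comes from a term \<open>N\<close> of \<open>f\<close> that is
  \<open>M\<close> itself or \<open>M\<close> with its pattern on the block replaced by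
  \<open>\<tau> k j\<close>. In the second case \<open>\<tau> k j\<close> is nonempty because
  \<open>k \<notin> tails \<tau> {}\<close>, so \<open>j\<close> is a head of \<open>N\<close>
  anyway and \<open>M\<close> mentions nothing new.\<close>

lemma avoid_support:
  assumes "avoid (Bl k j) (\<tau> k j) f M \<noteq> 0" "k \<in> S" "j \<in> S" "k \<noteq> j" "k \<notin> tails \<tau> {}"
  shows "M \<inter> Bl k j \<noteq> \<tau> k j \<and> (\<exists>N. f N \<noteq> 0 \<and> (N \<subseteq> V - T \<longrightarrow> M \<subseteq> V - T) \<and> mention \<tau> M \<subseteq> mention \<tau> N \<and>
     (\<forall>j'. j' \<noteq> j \<longrightarrow> N \<inter> Bl k j' = M \<inter> Bl k j'))"
proof -
  let ?B = "Bl k j"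
  have MB: "M \<inter> ?B \<noteq> \<tau> k j" and fM: "f M \<noteq> 0 \<or> f ((M - ?B) \<union> \<tau> k j) \<noteq> 0"
    using assms(1) by (auto simp: avoid_def split: if_splits)
  have N: "(N \<subseteq> V - T \<longrightarrow> M \<subseteq> V - T) \<and> mention \<tau> M \<subseteq> mention \<tau> N \<and> (\<forall>j'. j' \<noteq> j \<longrightarrow> N \<inter> Bl k j' = M \<inter> Bl k j')"
    if N: "N = (M - ?B) \<union> \<tau> k j" for N
  proof (intro conjI impI allI)
    show "M \<subseteq> V - T" if "N \<subseteq> V - T"
      using that Bl_V[of k j] assms N by auto
    have eqB: "N \<inter> Bl i' j' = M \<inter> Bl i' j'" if "(i', j') \<noteq> (k, j)" for i' j'
      using Bl_disjoint[OF that] \<tau>[of k j] N by auto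
    then show "N \<inter> Bl k j' = M \<inter> Bl k j'" if "j' \<noteq> j" for j'
      using that by blast
    have "\<tau> k j \<noteq> {}"
      using assms by (auto simp: tails_def)
    then have j: "j \<in> heads N"
      using N \<tau>[of k j] Bl_Hd[of k j] assms by (auto simp: heads_def)
    have "heads M \<subseteq> heads N"
    proof
      fix j' assume j': "j' \<in> heads M"
      show "j' \<in> heads N"
      proof (cases "j' = j")
        case False
        then have "?B \<inter> Hd j' = {}" using Bl_Hd_disjoint by auto
        then have "M \<inter> Hd j' = N \<inter> Hd j'" using N \<tau>[of k j] by auto
        then show ?thesis using j' by (simp add: heads_def)
      qed (use j in simp)
    qed
    moreover have "tails \<tau> M \<subseteq> tails \<tau> N"
    proof
      fix i assume "i \<in> tails \<tau> M"
      then obtain j' where ij': "i \<in> S" "j' \<in> S - {i}" "M \<inter> Bl i j' = \<tau> i j'" by (auto simp: tails_def)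
      then have "(i, j') \<noteq> (k, j)" using MB by auto
      then have "N \<inter> Bl i j' = \<tau> i j'" using eqB ij' by simp
      then show "i \<in> tails \<tau> N" using ij'(1,2) by (auto simp: tails_def)
    qed
    ultimately show "mention \<tau> M \<subseteq> mention \<tau> N" by (auto simp: mention_def)
  qed
  from fM show ?thesis
  proof
    assume "f M \<noteq> 0"
    then show ?thesis using MB by (intro conjI exI[of _ M]) auto
  next
    assume "f ((M - ?B) \<union> \<tau> k j) \<noteq> 0"
    then show ?thesis using MB N[OF refl] by (intro conjI exI[of _ "(M - ?B) \<union> \<tau> k j"]) simp_all
  qed
qed

lemma avoids_support:
  assumes "avoids \<tau> k js f M \<noteq> 0" "k \<in> S" "set js \<subseteq> S - {k}" "k \<notin> tails \<tau> {}"
  shows "(\<forall>j\<in>set js. M \<inter> Bl k j \<noteq> \<tau> k j) \<and> (\<exists>N. f N \<noteq> 0 \<and> (N \<subseteq> V - T \<longrightarrow> M \<subseteq> V - T) \<and> mention \<tau> M \<subseteq> mention \<tau> N)"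
  using assms
proof (induction js arbitrary: M)
  case Nil
  then show ?case by (auto simp: avoids_def)
next
  case (Cons j js)
  then have "avoid (Bl k j) (\<tau> k j) (avoids \<tau> k js f) M \<noteq> 0" by (simp add: avoids_def)
  moreover have j: "j \<in> S" "k \<noteq> j" using Cons.prems by auto
  ultimately have a: "M \<inter> Bl k j \<noteq> \<tau> k j \<and> (\<exists>N. avoids \<tau> k js f N \<noteq> 0 \<and> (N \<subseteq> V - T \<longrightarrow> M \<subseteq> V - T) \<and>
     mention \<tau> M \<subseteq> mention \<tau> N \<and> (\<forall>j'. j' \<noteq> j \<longrightarrow> N \<inter> Bl k j' = M \<inter> Bl k j'))"
    by (intro avoid_support) (use Cons.prems(2,4) in simp_all)
  from conjunct2[OF a] obtain N where N: "avoids \<tau> k js f N \<noteq> 0"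
    "N \<subseteq> V - T \<longrightarrow> M \<subseteq> V - T" "mention \<tau> M \<subseteq> mention \<tau> N" "\<forall>j'. j' \<noteq> j \<longrightarrow> N \<inter> Bl k j' = M \<inter> Bl k j'"
    by (elim exE conjE)
  have "set js \<subseteq> S - {k}" using Cons.prems(3) by simp
  from Cons.IH[OF N(1) Cons.prems(2) this Cons.prems(4)] obtain N' where
    N': "\<forall>j\<in>set js. N \<inter> Bl k j \<noteq> \<tau> k j" "f N' \<noteq> 0" "N' \<subseteq> V - T \<longrightarrow> N \<subseteq> V - T" "mention \<tau> N \<subseteq> mention \<tau> N'"
    by (elim exE conjE)
  have "\<forall>j'\<in>set (j # js). M \<inter> Bl k j' \<noteq> \<tau> k j'"
    using N(4) N'(1) conjunct1[OF a] by (metis set_ConsD)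
  moreover have "N' \<subseteq> V - T \<longrightarrow> M \<subseteq> V - T" "mention \<tau> M \<subseteq> mention \<tau> N'"
    using N(2,3) N'(3,4) by auto
  ultimately show ?case using N'(2) by blast
qed

lemma avoids_id:
  assumes "\<And>M j. f M \<noteq> 0 \<Longrightarrow> j \<in> set js \<Longrightarrow> M \<inter> Bl k j \<noteq> \<tau> k j"
  shows "avoids \<tau> k js f = f"
  using assms
proof (induction js)
  case (Cons j js)
  have "avoid (Bl k j) (\<tau> k j) f M = f M" for M
  proof -
    have "((M - Bl k j) \<union> \<tau> k j) \<inter> Bl k j = \<tau> k j" using \<tau>[of k j] by auto
    then have "f ((M - Bl k j) \<union> \<tau> k j) = 0" using Cons.prems by fastforce
    then show ?thesis using Cons.prems[of M j] by (auto simp: avoid_def)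
  qed
  moreover have "avoids \<tau> k js f = f" using Cons by simp
  ultimately show ?case by (auto simp: avoids_def)
qed (simp add: avoids_def)

lemma avoids_diff: "avoids \<tau> k js (\<lambda>M. f M - g M) = (\<lambda>M. avoids \<tau> k js f M - avoids \<tau> k js g M)"
proof (induction js)
  case (Cons j js)
  then show ?case by (auto simp: avoids_def avoid_def)
qed (simp add: avoids_def)

lemma ev_avoids:
  assumes "k \<in> S" "set js \<subseteq> S" "\<And>j. j \<in> set js \<Longrightarrow> a \<inter> Bl k j \<noteq> {}"
  shows "ev V (avoids \<tau> k js f) a = ev V f a"
  using assms(2,3)
proof (induction js)
  case (Cons j js)
  have "ev V (avoid (Bl k j) (\<tau> k j) (avoids \<tau> k js f)) a = ev V (avoids \<tau> k js f) a"
    by (rule ev_avoid) (use Cons.prems \<tau> Bl_V[OF assms(1), of j] finV in auto)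
  then show ?case using Cons by (simp add: avoids_def)
qed (simp add: avoids_def)

text \<open>
  Forgetting an element \<open>k\<close> puts it below all of \<open>A\<close>, pointing outside \<open>A\<close>: the variables with head
  \<open>k\<close> become constants, and in the blocks with tail \<open>k\<close>, which have nonempty patterns, the reserved
  character is expressed by the others.
\<close>

lemma forget:
  assumes A: "A \<subseteq> S" "k \<in> A" "card A < card S" and k: "k \<notin> tails \<tau> {}"
  obtains P :: "('v set \<Rightarrow> 'f::field) \<Rightarrow> 'v set \<Rightarrow> 'f" where
    "\<And>f g. P (\<lambda>M. f M - g M) = (\<lambda>M. P f M - P g M)"
    "\<And>f M. (\<And>M. f M \<noteq> 0 \<Longrightarrow> mention \<tau> M \<subseteq> A) \<Longrightarrow> P f M \<noteq> 0 \<Longrightarrow> \<exists>N. f N \<noteq> 0 \<and> mention \<tau> M \<subseteq> mention \<tau> N - {k}"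
    "\<And>f. (\<And>M. f M \<noteq> 0 \<Longrightarrow> k \<notin> mention \<tau> M) \<Longrightarrow> P f = f"
    "\<And>q. q \<in> ideal \<tau> A \<Longrightarrow> P q \<in> ideal \<tau> (A - {k})"
proof -
  have finA: "finite A" using A(1) finS finite_subset by blast
  have kS: "k \<in> S" using A by auto
  obtain js where js: "set js = A - {k}" using finA finite_list by (metis finite_Diff)
  from Sol_extend[OF A, folded Hd_def] obtain h where h: "h \<subseteq> Hd k"
    and ext: "\<forall>a\<in>Sol (A - {k}). (\<forall>j\<in>A - {k}. a \<inter> Bl k j \<noteq> {}) \<longrightarrow> (a - Hd k) \<union> h \<in> Sol A"
    by blast
  \<comment> \<open>First the reserved characters of the blocks from \<open>k\<close> into
    \<open>A\<close> are replaced, then the variables with head \<open>k\<close> become the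
    constants given by \<open>h\<close>.\<close>
  define P :: "('v set \<Rightarrow> 'f) \<Rightarrow> 'v set \<Rightarrow> 'f" where "P f = fixvars (Hd k) h (avoids \<tau> k js f)" for f
  have finHd: "finite (Hd k)" using Hd_V[OF kS] finV finite_subset by blast
  have jsS: "set js \<subseteq> S - {k}" using js A by auto
  have diff: "P (\<lambda>M. f M - g M) = (\<lambda>M. P f M - P g M)" for f g
    unfolding P_def avoids_diff by (auto simp: fixvars_def sum_subtractf left_diff_distrib)
  have supp: "\<exists>N. f N \<noteq> 0 \<and> (N \<subseteq> V - T \<longrightarrow> M \<subseteq> V - T) \<and> mention \<tau> M \<subseteq> mention \<tau> N - {k}"
    if f: "\<And>M. f M \<noteq> 0 \<Longrightarrow> mention \<tau> M \<subseteq> A" and M: "P f M \<noteq> 0" for f M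
  proof -
    have MH: "M \<inter> Hd k = {}" using M by (auto simp: P_def fixvars_def split: if_splits)
    have "(\<Sum>W\<in>Pow (Hd k). avoids \<tau> k js f (M \<union> W) * chi W h) \<noteq> 0"
      using M by (auto simp: P_def fixvars_def split: if_splits)
    then obtain W where W: "W \<subseteq> Hd k" "avoids \<tau> k js f (M \<union> W) \<noteq> 0"
      by (metis (no_types, lifting) PowD mult_zero_left sum.neutral)
    let ?M = "M \<union> W"
    obtain N where N: "\<forall>j\<in>A - {k}. ?M \<inter> Bl k j \<noteq> \<tau> k j" "f N \<noteq> 0" "N \<subseteq> V - T \<longrightarrow> ?M \<subseteq> V - T" "mention \<tau> ?M \<subseteq> mention \<tau> N"
      using avoids_support[OF W(2) kS jsS k] js by auto
    have eqB: "M \<inter> Bl i j = ?M \<inter> Bl i j" if "j \<noteq> k" for i j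
      using Bl_Hd_disjoint[OF that] W by auto
    have "heads M \<subseteq> heads ?M" by (auto simp: heads_def)
    moreover have "k \<notin> heads M" using MH by (simp add: heads_def)
    \<comment> \<open>A block with head \<open>k\<close> has been emptied, so it matches
      \<open>\<tau>\<close> only if its reserved character is empty, a case covered by
      \<open>tails \<tau> {}\<close>.\<close>
    moreover have tl: "tails \<tau> M \<subseteq> tails \<tau> ?M \<union> tails \<tau> {}"
    proof
      fix i assume "i \<in> tails \<tau> M"
      then obtain j where j: "i \<in> S" "j \<in> S - {i}" "M \<inter> Bl i j = \<tau> i j" by (auto simp: tails_def)
      show "i \<in> tails \<tau> ?M \<union> tails \<tau> {}"
      proof (cases "j = k")
        case True
        then have "M \<inter> Bl i j = {}" using MH Bl_Hd[of i k] j by auto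
        then show ?thesis using j by (auto simp: tails_def)
      next
        case False
        then have "?M \<inter> Bl i j = \<tau> i j" using eqB[OF False, of i] j(3) by (rule_tac trans[OF sym]) auto
        then show ?thesis using j by (auto simp: tails_def)
      qed
    qed
    moreover have "k \<notin> tails \<tau> M"
    proof
      assume "k \<in> tails \<tau> M"
      then obtain j where j: "j \<in> S - {k}" "M \<inter> Bl k j = \<tau> k j" by (auto simp: tails_def)
      then have e: "?M \<inter> Bl k j = \<tau> k j" using eqB[of j k] by simp
      \<comment> \<open>For \<open>j \<in> A\<close> the matching pattern was removed by
        \<open>avoids\<close>. For \<open>j\<close> outside \<open>A\<close> no term of
        \<open>f\<close> has head \<open>j\<close>, so the block is empty in the term at hand and
        cannot match the nonempty \<open>\<tau> k j\<close>.\<close>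
      then have "j \<notin> A" using N j by auto
      then have "j \<notin> heads ?M" using N(4) f[OF N(2)] by (auto simp: mention_def)
      then have "?M \<inter> Bl k j = {}" using j Bl_Hd[of k j] kS by (auto simp: heads_def)
      then show False using e k j kS by (auto simp: tails_def)
    qed
    ultimately have "mention \<tau> M \<subseteq> mention \<tau> ?M - {k}" using k by (auto simp: mention_def)
    then show ?thesis using N by blast
  qed
  have fixp: "P f = f" if f: "\<And>M. f M \<noteq> 0 \<Longrightarrow> k \<notin> mention \<tau> M" for f
  proof -
    have "avoids \<tau> k js f = f"
      by (rule avoids_id) (use f js A kS in \<open>force simp: mention_def tails_def\<close>)
    moreover have "fixvars (Hd k) h f M = f M" for M
    proof -
      have z: "f M' = 0" if "M' \<inter> Hd k \<noteq> {}" for M'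
        using f[of M'] that kS by (auto simp: mention_def heads_def)
      show ?thesis
      proof (cases "M \<inter> Hd k = {}")
        case True
        have "(\<Sum>W\<in>Pow (Hd k). f (M \<union> W) * chi W h) = (\<Sum>W\<in>{{}}. f (M \<union> W) * chi W h)"
          by (rule sum.mono_neutral_right) (use finHd in \<open>auto intro!: z\<close>)
        then show ?thesis using True by (simp add: fixvars_def)
      qed (use z in \<open>simp add: fixvars_def\<close>)
    qed
    ultimately show ?thesis by (auto simp: P_def)
  qed
  have id: "P q \<in> ideal \<tau> (A - {k})" if q: "q \<in> ideal \<tau> A" for q
  proof -
    have q1: "\<And>M. q M \<noteq> 0 \<Longrightarrow> M \<subseteq> V - T \<and> mention \<tau> M \<subseteq> A" and q2: "\<And>a. a \<in> Sol A \<Longrightarrow> ev V q a = 0"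
      using q by (auto simp: ideal_def)
    have s: "M \<subseteq> V - T \<and> mention \<tau> M \<subseteq> A - {k}" if "P q M \<noteq> 0" for M
      using supp[of q M] q1 that by blast
    \<comment> \<open>If \<open>k\<close> is below all of \<open>A - {k}\<close>, overwriting the
      variables with head \<open>k\<close> by \<open>h\<close> gives an assignment in
      \<open>Sol A\<close>, and the value of \<open>P q\<close> at \<open>a\<close> is that of
      \<open>q\<close> at the new assignment.\<close>
    have z1: "ev V (P q) a = 0" if a: "a \<in> Sol (A - {k})" "\<And>j. j \<in> A - {k} \<Longrightarrow> a \<inter> Bl k j \<noteq> {}" for a
    proof -
      let ?a = "(a - Hd k) \<union> h"
      have "ev V (P q) a = ev V (avoids \<tau> k js q) ?a"
        unfolding P_def by (rule ev_fixvars) (use finV Hd_V[OF kS] h in auto)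
      also have "\<dots> = ev V q ?a"
      proof (rule ev_avoids)
        fix j assume "j \<in> set js"
        then have j: "j \<in> A - {k}" using js by simp
        then have "Bl k j \<inter> Hd k = {}" using Bl_Hd_disjoint by auto
        then show "?a \<inter> Bl k j \<noteq> {}" using a(2)[OF j] h by auto
      qed (use kS jsS in auto)
      also have "\<dots> = 0" by (rule q2) (use ext a in blast)
      finally show ?thesis .
    qed
    \<comment> \<open>The set \<open>J\<close> contains the elements whose block from
      \<open>k\<close> may be empty. An empty block is treated through its nonempty patterns, for
      which \<open>J\<close> shrinks; this works because \<open>P q\<close> has no monomial with the
      reserved pattern there.\<close>
    have z2: "ev V (P q) a = 0" if "a \<in> Sol (A - {k})" "J \<subseteq> A - {k}" "\<And>j. j \<in> A - {k} - J \<Longrightarrow> a \<inter> Bl k j \<noteq> {}" for a J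
    proof -
      have "finite J" using that(2) finA finite_subset by blast
      then show ?thesis using that
      proof (induction J arbitrary: a rule: finite_induct)
        case empty
        then show ?case using z1 by auto
      next
        case (insert j J)
        then have j: "j \<in> A - {k}" "j \<in> S" "k \<noteq> j" using A by auto
        show ?case
        proof (cases "a \<inter> Bl k j = {}")
          case True
          have "ev V (P q) (a - Bl k j) = 0"
          proof (rule ev_zero_on_empty_block[where \<tau> = "\<tau> k j"])
            show "M \<inter> Bl k j \<noteq> \<tau> k j" if "P q M \<noteq> 0" for M
            proof -
              have "k \<notin> tails \<tau> M" using s[OF that] by (auto simp: mention_def)
              then show ?thesis using j kS by (auto simp: tails_def)
            qed
            show "ev V (P q) (a - Bl k j \<union> P') = 0" if P': "P' \<subseteq> Bl k j" "P' \<noteq> {}" for P'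
            proof (rule insert.IH)
              show "a - Bl k j \<union> P' \<in> Sol (A - {k})"
                by (rule Sol_block) (use A kS j insert.prems P' in auto)
              show "J \<subseteq> A - {k}" using insert.prems by auto
              show "(a - Bl k j \<union> P') \<inter> Bl k j' \<noteq> {}" if j': "j' \<in> A - {k} - J" for j'
              proof (cases "j' = j")
                case True
                then show ?thesis using P' by auto
              next
                case False
                then have "Bl k j \<inter> Bl k j' = {}" using Bl_disjoint by auto
                moreover have "a \<inter> Bl k j' \<noteq> {}" using insert.prems(3)[of j'] j' False by auto
                ultimately show ?thesis by auto
              qed
            qed
          qed (use finV \<tau> Bl_V[OF kS j(2)] in auto)
          moreover have "a - Bl k j = a" using True by auto
          ultimately show ?thesis by simp
        next
          case False
          then show ?thesis by (intro insert.IH) (use insert.prems in auto)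
        qed
      qed
    qed
    have "ev V (P q) a = 0" if "a \<in> Sol (A - {k})" for a
      using z2[OF that order_refl] by auto
    then show ?thesis using s by (simp add: ideal_def)
  qed
  show ?thesis
  proof (rule that[of P])
    show "\<exists>N. f N \<noteq> 0 \<and> mention \<tau> M \<subseteq> mention \<tau> N - {k}" if "\<And>M. f M \<noteq> 0 \<Longrightarrow> mention \<tau> M \<subseteq> A" "P f M \<noteq> 0" for f M
      using supp[OF that] by auto
  qed (fact diff fixp id)+
qed

text \<open>Forgetting an element \<open>k\<close> of the set splits \<open>q\<close> into
  \<open>P q\<close>, which belongs to the smaller set \<open>A - {k}\<close>, and
  \<open>q - P q\<close>. The terms of \<open>q\<close> that mention all the other elements of
  \<open>B\<close> miss \<open>k\<close>, so \<open>P\<close> fixes them and they cancel in the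
  difference. Each remaining term misses one of the other elements, and the induction
  applies.\<close>

lemma telescope:
  assumes A: "A \<subseteq> S" "card A < card S" and "finite B" "B \<subseteq> A - tails \<tau> {}"
    and "q \<in> ideal \<tau> A" "\<And>M. q M \<noteq> 0 \<Longrightarrow> \<exists>a\<in>B. a \<notin> mention \<tau> M"
  shows "(q :: 'v set \<Rightarrow> 'f::field) \<in> null_polys \<tau> (card A - 1)"
  using assms(3-6)
proof (induction B arbitrary: q rule: finite_induct)
  case empty
  then have "q = (\<lambda>_. 0)" by auto
  then show ?case using null_polys.zero by simp
next
  case (insert k B)
  have k: "k \<in> A" "k \<notin> tails \<tau> {}" using insert.prems by auto
  obtain P :: "('v set \<Rightarrow> 'f) \<Rightarrow> 'v set \<Rightarrow> 'f" where
    P1: "\<And>f g. P (\<lambda>M. f M - g M) = (\<lambda>M. P f M - P g M)" and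
    P2: "\<And>f M. (\<And>M. f M \<noteq> 0 \<Longrightarrow> mention \<tau> M \<subseteq> A) \<Longrightarrow> P f M \<noteq> 0 \<Longrightarrow> \<exists>N. f N \<noteq> 0 \<and> mention \<tau> M \<subseteq> mention \<tau> N - {k}" and
    P3: "\<And>f. (\<And>M. f M \<noteq> 0 \<Longrightarrow> k \<notin> mention \<tau> M) \<Longrightarrow> P f = f" and
    P4: "\<And>q. q \<in> ideal \<tau> A \<Longrightarrow> P q \<in> ideal \<tau> (A - {k})"
    by (rule forget[OF A(1) k(1) A(2) k(2)]) blast
  have qA: "mention \<tau> M \<subseteq> A" if "q M \<noteq> 0" for M
    using insert.prems(2) that by (simp add: ideal_def)
  have card: "card (A - {k}) \<le> card A - 1"
    using k A finS by (simp add: card_Diff_singleton finite_subset)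
  have Pq: "P q \<in> ideal \<tau> (A - {k})" using P4 insert.prems by blast
  then have Pq': "P q \<in> ideal \<tau> A" by (rule ideal_mono[rotated]) auto
  define q1 where "q1 M = (if \<exists>b\<in>B. b \<notin> mention \<tau> M then 0 else q M)" for M
  define q2 where "q2 M = q M - q1 M" for M
  have "P q1 = q1"
    by (rule P3) (use insert.prems(3) in \<open>auto simp: q1_def split: if_splits\<close>)
  moreover have "P q2 = (\<lambda>M. P q M - P q1 M)"
    unfolding q2_def[abs_def] by (rule P1)
  ultimately have eq: "(\<lambda>M. q M - P q M) = (\<lambda>M. q2 M - P q2 M)"
    by (auto simp: q2_def)
  have q2: "(\<exists>b\<in>B. b \<notin> mention \<tau> M) \<and> mention \<tau> M \<subseteq> A" if "q2 M \<noteq> 0" for M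
    using that qA[of M] by (auto simp: q2_def q1_def split: if_splits)
  have "(\<lambda>M. q M - P q M) \<in> null_polys \<tau> (card A - 1)"
  proof (rule insert.IH)
    show "(\<lambda>M. q M - P q M) \<in> ideal \<tau> A" by (rule ideal_diff) (use insert.prems Pq' in auto)
    fix M assume "q M - P q M \<noteq> 0"
    then have "q2 M - P q2 M \<noteq> 0" using fun_cong[OF eq, of M] by simp
    then consider "q2 M \<noteq> 0" | "P q2 M \<noteq> 0" by force
    then show "\<exists>b\<in>B. b \<notin> mention \<tau> M"
    proof cases
      case 2
      then obtain N where "q2 N \<noteq> 0" "mention \<tau> M \<subseteq> mention \<tau> N - {k}" using P2[of q2 M] q2 by blast
      then show ?thesis using q2 by blast
    qed (use q2 in blast)
  qed (use insert.prems in auto)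
  moreover have "P q \<in> null_polys \<tau> (card A - 1)"
    by (rule null_ideal[OF Pq]) (use A card in auto)
  ultimately show ?case using null_add by fastforce
qed

text \<open>Take \<open>card A = Suc d\<close>. A term of \<open>q A\<close> that mentions all of
  \<open>A\<close> occurs in no other summand, so it would survive in \<open>f\<close>, whose terms
  mention at most \<open>d\<close> elements. Hence every term of \<open>q A\<close> misses an
  element of \<open>A\<close>, and \<open>telescope\<close> rewrites \<open>q A\<close> with smaller
  sets.\<close>

lemma trim_step:
  assumes f: "f \<in> null_polys \<tau> (Suc d)" and d: "Suc d < card S" and small: "\<And>M. f M \<noteq> 0 \<Longrightarrow> card (mention \<tau> M) \<le> d"
  shows "f \<in> null_polys \<tau> d"
proof -
  let ?I = "{A. A \<subseteq> S \<and> card A \<le> Suc d}"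
  obtain q where q: "\<And>A. q A \<in> ideal \<tau> A" and fq: "f = (\<lambda>M. \<Sum>A\<in>?I. q A M)"
    using null_repr[OF f] by auto
  have finI: "finite ?I" using finS by simp
  have "q A \<in> null_polys \<tau> d" if A: "A \<in> ?I" for A
  proof (cases "card A \<le> d")
    case True
    then show ?thesis using null_ideal[OF q] A by auto
  next
    case False
    then have cA: "card A = Suc d" using A by auto
    have finA: "finite A" using A finS finite_subset by auto
    have "\<exists>a\<in>A - tails \<tau> {}. a \<notin> mention \<tau> M" if M: "q A M \<noteq> 0" for M
    proof (rule ccontr)
      assume "\<not> ?thesis"
      then have "A \<subseteq> mention \<tau> M" by (auto simp: mention_def)
      moreover have sub: "mention \<tau> M \<subseteq> A" using q[of A] M by (simp add: ideal_def)
      ultimately have mention: "mention \<tau> M = A" by simp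
      have "q A' M = 0" if "A' \<in> ?I - {A}" for A'
      proof (rule ccontr)
        assume "q A' M \<noteq> 0"
        then have "A \<subseteq> A'" using q[of A'] mention by (auto simp: ideal_def)
        moreover have "finite A'" "card A' \<le> card A" using that cA finS finite_subset by auto
        ultimately have "A = A'" by (metis card_seteq)
        then show False using that by simp
      qed
      then have "f M = q A M"
        unfolding fq by (subst sum.remove[OF finI A]) simp
      then show False using small[of M] M mention cA by simp
    qed
    then have "q A \<in> null_polys \<tau> (card A - 1)"
      by (intro telescope[where B = "A - tails \<tau> {}"]) (use A d cA q finA in auto)
    then show ?thesis using cA by simp
  qed
  then show ?thesis unfolding fq by (intro null_sum finI) auto
qed

lemma trim:
  assumes "f \<in> null_polys \<tau> D" "D < card S" "\<And>M. f M \<noteq> 0 \<Longrightarrow> card (mention \<tau> M) \<le> d" "d \<le> D"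
  shows "f \<in> null_polys \<tau> d"
  using assms(4,1,2)
proof (induction D rule: dec_induct)
  case (step D)
  then have "f \<in> null_polys \<tau> D"
    by (rule_tac trim_step[OF _ _ order_trans[OF assms(3) step.hyps(1)]]) auto
  then show ?case using step by simp
qed

text \<open>The monomial \<open>{}\<close> mentions nothing, so \<open>trim\<close> leads down to
  size 0, where \<open>1\<close> would have to vanish on the nonempty \<open>Sol {}\<close>.\<close>

lemma one_not_null:
  assumes "D < card S" "tails \<tau> {} = {}"
  shows "(\<lambda>M. if M = {} then 1 else 0 :: 'f::field) \<notin> null_polys \<tau> D"
proof
  let ?f = "\<lambda>M. if M = {} then 1 else 0 :: 'f"
  assume f: "?f \<in> null_polys \<tau> D"
  have mention: "mention \<tau> {} = {}" using assms(2) by (simp add: mention_def heads_def)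
  have "?f \<in> null_polys \<tau> 0"
  proof (rule trim[OF f assms(1)])
    fix M :: "'v set" assume "?f M \<noteq> 0"
    then have "M = {}" by presburger
    then show "card (mention \<tau> M) \<le> 0" using mention by simp
  qed simp
  from null_repr[OF this] obtain q where q: "\<And>A. q A \<in> ideal \<tau> A"
    "?f = (\<lambda>M. \<Sum>A\<in>{A. A \<subseteq> S \<and> card A \<le> 0}. q A M)" by auto
  have "{A. A \<subseteq> S \<and> card A \<le> 0} = {{}}" using finS finite_subset by fastforce
  then have f: "?f \<in> ideal \<tau> {}" using q(1)[of "{}"] unfolding q(2) by simp
  obtain a where "a \<in> Sol {}" using Sol_nonempty by auto
  then have "ev V ?f a = 0" using f by (auto simp: ideal_def)
  moreover have "ev V ?f a = (\<Sum>M\<in>{{}}. ?f M * chi M a)"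
    unfolding ev_def by (rule sum.mono_neutral_right) (use finV in auto)
  ultimately show False by simp
qed

end

end

section \<open>The invariant of the lines of a refutation\<close>

text \<open>\<open>\<X>\<close> contains the monomials of the refutation. Each matches the reserved
  characters \<open>\<sigma>\<close> at no more than \<open>e\<close> tails, and a quotient without
  split variables has no more than \<open>h\<close> heads. The number in \<open>room\<close> is the
  size \<open>2 * e + h + 3\<close> of the invariant plus \<open>e + h + 1\<close>, the cost of
  moving to another base monomial and of one variable.\<close>

locale pc_worlds = local_worlds V T S Bl Yv Sol
  for V T :: "'v set" and S :: "'s set" and Bl :: "'s \<Rightarrow> 's \<Rightarrow> 'v set"
    and Yv :: "'s \<Rightarrow> 'v set" and Sol :: "'s set \<Rightarrow> 'v set set" +
  fixes \<sigma> :: "'s \<Rightarrow> 's \<Rightarrow> 'v set" and \<X> :: "'v set set" and e h :: nat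
  assumes \<sigma>_Bl: "\<sigma> i j \<subseteq> Bl i j" and \<sigma>_nonempty: "i \<in> S \<Longrightarrow> j \<in> S \<Longrightarrow> \<sigma> i j \<noteq> {}"
    and \<X>_V: "m \<in> \<X> \<Longrightarrow> m \<subseteq> V"
    and \<X>_tails: "m \<in> \<X> \<Longrightarrow> card (tails \<sigma> m) \<le> e"
    and \<X>_heads: "m \<in> \<X> \<Longrightarrow> m' \<in> \<X> \<Longrightarrow> (m \<triangle> m') \<inter> T = {} \<Longrightarrow> card (heads (m \<triangle> m')) \<le> h"
    and room: "3 * e + 2 * h + 4 < card S"
begin

text \<open>Division by the base \<open>m\<close> turns the pattern \<open>\<sigma> i j\<close> into
  this one: \<open>M\<close> matches the shifted character exactly if \<open>M \<triangle> m\<close>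
  matches \<open>\<sigma>\<close>.\<close>

definition shifted :: "'v set \<Rightarrow> 's \<Rightarrow> 's \<Rightarrow> 'v set" where
  "shifted m i j = \<sigma> i j \<triangle> (m \<inter> Bl i j)"

text \<open>The class of terms of \<open>f\<close> that can interact with \<open>m\<close>, those
  whose quotient by \<open>m\<close> is free of split variables, divided by
  \<open>m\<close>.\<close>

definition part :: "'v set \<Rightarrow> ('v set \<Rightarrow> 'f::field) \<Rightarrow> 'v set \<Rightarrow> 'f" where
  "part m f M = (if M \<inter> T = {} then f (M \<triangle> m) else 0)"

text \<open>
  Quantifying over all base monomials \<open>m\<close> makes the invariant trivially closed under linear
  combinations, and multiplication by a variable only changes the base.
\<close>

definition invariant :: "('v set \<Rightarrow> 'f::field) \<Rightarrow> bool" where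
  "invariant f \<longleftrightarrow> (\<forall>m\<in>\<X>. part m f \<in> null_polys (shifted m) (2 * e + h + 3))"

lemma shifted_Bl: "shifted m i j \<subseteq> Bl i j"
  using \<sigma>_Bl[of i j] by (auto simp: shifted_def)

lemma tails_shifted: "tails (shifted m) M = tails \<sigma> (M \<triangle> m)"
proof -
  have "M \<inter> Bl i j = shifted m i j \<longleftrightarrow> (M \<triangle> m) \<inter> Bl i j = \<sigma> i j" for i j
    using \<sigma>_Bl[of i j] unfolding shifted_def set_eq_iff by auto
  then show ?thesis by (simp add: tails_def)
qed

lemma mention_shifted: "mention (shifted m) M = tails \<sigma> m \<union> heads M \<union> tails \<sigma> (M \<triangle> m)"
  by (simp add: mention_def tails_shifted)

lemma heads_S: "heads M \<subseteq> S" and tails_S: "tails \<tau> M \<subseteq> S"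
  by (auto simp: heads_def tails_def)

lemma heads_symdiff: "heads (M \<triangle> N) \<subseteq> heads M \<union> heads N"
  by (auto simp: heads_def)

lemma heads_mono: "M \<subseteq> N \<Longrightarrow> heads M \<subseteq> heads N"
  by (auto simp: heads_def)

lemma card_Un3_le: "card (A \<union> B \<union> C) \<le> card A + card B + card C"
  by (meson card_Un_le order_trans add_mono le_refl)

text \<open>A term mentions at most \<open>e\<close> tails of \<open>m\<close>, \<open>h\<close>
  heads and \<open>e\<close> tails of \<open>M \<triangle> m\<close>, hence at most
  \<open>2 * e + h\<close> elements. The extra 3 leaves room for the indices of an axiom.\<close>

lemma part_trim:
  assumes m: "m \<in> \<X>" and f: "\<And>M. f M \<noteq> 0 \<Longrightarrow> M \<in> \<X>"
    and D: "part m f \<in> null_polys (shifted m) D" "D < card S" "2 * e + h + 3 \<le> D"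
  shows "part m f \<in> null_polys (shifted m) (2 * e + h + 3)"
proof (rule trim[OF shifted_Bl D(1,2) _ D(3)])
  fix M assume "part m f M \<noteq> 0"
  then have M: "M \<inter> T = {}" "M \<triangle> m \<in> \<X>"
    using f by (auto simp: part_def split: if_splits)
  have eq: "m \<triangle> (M \<triangle> m) = M" by auto
  have "card (heads M) \<le> h"
    using \<X>_heads[OF m M(2)] M(1) unfolding eq by simp
  then show "card (mention (shifted m) M) \<le> 2 * e + h + 3"
    unfolding mention_shifted
    using card_Un3_le[of "tails \<sigma> m" "heads M" "tails \<sigma> (M \<triangle> m)"] \<X>_tails[OF m] \<X>_tails[OF M(2)] by simp
qed

lemma invariant_zero: "invariant (\<lambda>_. 0 :: 'f::field)"
proof -
  have "part m (\<lambda>_. 0 :: 'f) = (\<lambda>_. 0)" for m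
    by (auto simp: part_def)
  then show ?thesis by (simp add: invariant_def null_polys.zero)
qed

lemma invariant_comb: "invariant f \<Longrightarrow> invariant g \<Longrightarrow> invariant (\<lambda>M. \<alpha> * f M + \<beta> * g M)"
proof -
  assume fg: "invariant f" "invariant g"
  have "part m (\<lambda>M. \<alpha> * f M + \<beta> * g M) = (\<lambda>M. \<alpha> * part m f M + \<beta> * part m g M)" for m
    by (auto simp: part_def)
  then show ?thesis
    using fg by (auto simp: invariant_def intro!: null_add null_cmult)
qed

text \<open>Passing from base \<open>m'\<close> to base \<open>m\<close> multiplies by the monomial
  \<open>M0\<close>, which preserves the zeros on \<open>Sol\<close>. New mentions come from the
  heads of \<open>M0\<close>, from the tails of \<open>m\<close>, and from the block that contains
  \<open>v\<close>, whose pattern may become a reserved one; \<open>C\<close> collects them.\<close>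

lemma null_shift:
  assumes "g \<in> null_polys (shifted m') d" and M0: "M0 \<subseteq> V - T" "M0 \<triangle> m = m' \<triangle> {v}"
    and C: "C = heads M0 \<union> tails \<sigma> m \<union> {i \<in> S. \<exists>j\<in>S. v \<in> Bl i j}"
  shows "(\<lambda>M. g (M \<triangle> M0)) \<in> null_polys (shifted m) (d + card C)"
  using assms(1)
proof (induction rule: null_polys.induct)
  case zero
  then show ?case by (simp add: null_polys.zero)
next
  case (step q A f)
  have q: "q N \<noteq> 0 \<Longrightarrow> N \<subseteq> V - T \<and> mention (shifted m') N \<subseteq> A" and qz: "a \<in> Sol A \<Longrightarrow> ev V q a = 0" for N a
    using step.hyps by (auto simp: ideal_def)
  have CS: "C \<subseteq> S" using C heads_S tails_S by auto
  have "(\<lambda>M. q (M \<triangle> M0)) \<in> ideal (shifted m) (A \<union> C)"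
    unfolding ideal_def
  proof (intro CollectI conjI allI impI ballI)
    fix M assume "q (M \<triangle> M0) \<noteq> 0"
    note N = q[OF this]
    show "M \<subseteq> V - T" using symdiff_subset[of "M \<triangle> M0" "V - T" M0] N M0(1) by simp
    have h: "heads M \<subseteq> A \<union> C"
      using heads_symdiff[of "M \<triangle> M0" M0] N C by (auto simp: mention_def)
    have eq: "M \<triangle> m = ((M \<triangle> M0) \<triangle> m') \<triangle> {v}"
      using M0(2) by (metis symdiff_assoc symdiff_cancel(1))
    have t: "tails \<sigma> (Z \<triangle> {v}) \<subseteq> tails \<sigma> Z \<union> C" for Z
    proof
      fix i assume "i \<in> tails \<sigma> (Z \<triangle> {v})"
      then obtain j where j: "i \<in> S" "j \<in> S - {i}" "(Z \<triangle> {v}) \<inter> Bl i j = \<sigma> i j" by (auto simp: tails_def)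
      show "i \<in> tails \<sigma> Z \<union> C"
      proof (cases "v \<in> Bl i j")
        case True
        then show ?thesis using j C by auto
      next
        case False
        then have "Z \<inter> Bl i j = (Z \<triangle> {v}) \<inter> Bl i j" by auto
        then show ?thesis using j by (auto simp: tails_def)
      qed
    qed
    have "tails \<sigma> (M \<triangle> m) \<subseteq> A \<union> C"
      using t[of "(M \<triangle> M0) \<triangle> m'"] N unfolding eq mention_shifted by auto
    moreover have "tails \<sigma> m \<subseteq> C" using C by blast
    ultimately show "mention (shifted m) M \<subseteq> A \<union> C"
      using h unfolding mention_shifted by blast
  next
    fix a assume "a \<in> Sol (A \<union> C)"
    then have "ev V q a = 0" using Sol_antimono[of A "A \<union> C"] qz by auto
    then show "ev V (\<lambda>M. q (M \<triangle> M0)) a = 0"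
      using M0(1) finV by (subst ev_shift) auto
  qed
  moreover have "card (A \<union> C) \<le> d + card C"
    using card_Un_le[of A C] step.hyps by simp
  ultimately show ?case
    using step.hyps CS step.IH by (intro null_polys.step) auto
qed

lemma card_block_index: "card {i \<in> S. \<exists>j\<in>S. v \<in> Bl i j} \<le> 1"
proof -
  have "i = i'" if "i \<in> {i \<in> S. \<exists>j\<in>S. v \<in> Bl i j}" "i' \<in> {i \<in> S. \<exists>j\<in>S. v \<in> Bl i j}" for i i'
    using that Bl_disjoint by fastforce
  then show ?thesis
    using card_le_Suc0_iff_eq[of "{i \<in> S. \<exists>j\<in>S. v \<in> Bl i j}"] finS by simp
qed

lemma invariant_var:
  assumes f: "invariant f" "\<And>M. f M \<noteq> 0 \<Longrightarrow> M \<in> \<X>" and f': "\<And>M. f (M \<triangle> {v}) \<noteq> 0 \<Longrightarrow> M \<in> \<X>"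
  shows "invariant (\<lambda>M. f (M \<triangle> {v}))"
  unfolding invariant_def
proof
  let ?f = "\<lambda>M. f (M \<triangle> {v})"
  fix m assume m: "m \<in> \<X>"
  show "part m ?f \<in> null_polys (shifted m) (2 * e + h + 3)"
  proof (cases "\<exists>M. part m ?f M \<noteq> 0")
    case False
    then have "part m ?f = (\<lambda>_. 0)" by auto
    then show ?thesis by (simp add: null_polys.zero)
  next
    case True
    then obtain M0 where M0: "M0 \<inter> T = {}" "f ((M0 \<triangle> m) \<triangle> {v}) \<noteq> 0"
      by (auto simp: part_def split: if_splits)
    \<comment> \<open>\<open>M0\<close> is one term of the part, taken as reference. The monomial
      \<open>m'\<close> of \<open>f\<close> from which it stems belongs to \<open>\<X>\<close>, so
      the invariant of \<open>f\<close> at base \<open>m'\<close> can be shifted to base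
      \<open>m\<close>.\<close>
    define m' where "m' = (M0 \<triangle> m) \<triangle> {v}"
    have X: "M0 \<triangle> m \<in> \<X>" "m' \<in> \<X>" using M0(2) f f' by (auto simp: m'_def)
    have M0V: "M0 \<subseteq> V - T"
      using \<X>_V[OF X(1)] \<X>_V[OF m] M0(1) by fastforce
    have "part m' f \<in> null_polys (shifted m') (2 * e + h + 3)" using f(1) X by (simp add: invariant_def)
    from null_shift[OF this M0V _ refl, of m v]
    have "(\<lambda>M. part m' f (M \<triangle> M0)) \<in> null_polys (shifted m)
       (2 * e + h + 3 + card (heads M0 \<union> tails \<sigma> m \<union> {i \<in> S. \<exists>j\<in>S. v \<in> Bl i j}))" (is "_ \<in> null_polys _ ?D")
      by (simp add: m'_def)
    also have "(\<lambda>M. part m' f (M \<triangle> M0)) = part m ?f"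
    proof
      fix M
      have "(M \<triangle> M0) \<inter> T = M \<inter> T" using M0(1) by auto
      moreover have "(M \<triangle> M0) \<triangle> m' = (M \<triangle> m) \<triangle> {v}" by (auto simp: m'_def)
      ultimately show "part m' f (M \<triangle> M0) = part m ?f M" by (simp add: part_def)
    qed
    finally have *: "part m ?f \<in> null_polys (shifted m) ?D" .
    have eq: "m \<triangle> (M0 \<triangle> m) = M0" by auto
    have "card (heads M0) \<le> h" using \<X>_heads[OF m X(1)] M0(1) unfolding eq by simp
    then have "?D < card S"
      using card_Un3_le[of "heads M0" "tails \<sigma> m" "{i \<in> S. \<exists>j\<in>S. v \<in> Bl i j}"] \<X>_tails[OF m]
        card_block_index[of v] room by linarith
    then show ?thesis
      using part_trim[OF m _ *] f' by simp
  qed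
qed

text \<open>Twisting by the character \<open>m \<inter> T\<close> over the patterns of
  \<open>T\<close> isolates the terms that agree with \<open>m\<close> on \<open>T\<close>.
  Cancelling the factor \<open>2 ^ card T\<close> uses that 2 is nonzero, and the shift by
  \<open>m\<close> then gives the part.\<close>

lemma ev_part_zero:
  assumes two: "(2 :: 'f::field) \<noteq> 0" and m: "m \<subseteq> V" and a: "\<And>P. P \<subseteq> T \<Longrightarrow> ev V f ((a - T) \<union> P) = 0"
  shows "ev V (part m f) a = (0 :: 'f)"
proof -
  have finT: "finite T" using T_V finV finite_subset by blast
  define g where "g N = (if N \<inter> T = m \<inter> T then f N else 0)" for N
  have eq: "(M \<triangle> m) \<inter> T = m \<inter> T \<longleftrightarrow> M \<inter> T = {}" for M by auto
  have pg: "part m f = (\<lambda>M. g (M \<triangle> m))"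
    unfolding part_def g_def eq by auto
  have "2 ^ card T * (\<Sum>N\<in>Pow V. if N \<inter> T = m \<inter> T then f N * chi (N - T) a else 0) =
      (\<Sum>P\<in>Pow T. chi (m \<inter> T) P * ev V f ((a - T) \<union> P))"
    by (rule ev_twist[symmetric]) (use finV T_V in auto)
  also have "\<dots> = 0" by (rule sum.neutral) (use a in auto)
  finally have z: "(\<Sum>N\<in>Pow V. if N \<inter> T = m \<inter> T then f N * chi (N - T) a else 0) = 0"
    using two by simp
  have "ev V g a = (\<Sum>N\<in>Pow V. chi (m \<inter> T) a * (if N \<inter> T = m \<inter> T then f N * chi (N - T) a else 0))"
    unfolding ev_def
  proof (rule sum.cong[OF refl])
    fix N assume "N \<in> Pow V"
    then have "finite N" using finV finite_subset by auto
    then have "chi (N - T) a * chi (N \<inter> T) a = (chi N a :: 'f)"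
      by (subst chi_Un[symmetric]) (auto simp: Un_Diff_Int)
    then show "g N * chi N a = chi (m \<inter> T) a * (if N \<inter> T = m \<inter> T then f N * chi (N - T) a else 0)"
      by (auto simp: g_def algebra_simps)
  qed
  also have "\<dots> = 0" using z by (simp flip: sum_distrib_left)
  finally show ?thesis unfolding pg using finV m by (subst ev_shift) auto
qed

text \<open>The part at \<open>m\<close> lies in a single ideal: its terms differ from one fixed
  quotient \<open>M0\<close> only in variables of \<open>W\<close>, so besides the tails of
  \<open>m\<close> and the heads of \<open>M0\<close> they mention only the at most three indices in
  \<open>I\<close>.\<close>

lemma invariant_axiom:
  assumes two: "(2 :: 'f::field) \<noteq> 0"
    and X: "\<And>M. f M \<noteq> 0 \<Longrightarrow> M \<in> \<X>" and W: "\<And>M. f M \<noteq> 0 \<Longrightarrow> M \<subseteq> W"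
    and I: "I \<subseteq> S" "card I \<le> 3" "heads W \<subseteq> I" "\<And>i j. i \<in> S \<Longrightarrow> j \<in> S \<Longrightarrow> W \<inter> Bl i j \<noteq> {} \<Longrightarrow> i \<in> I"
    and zero: "\<And>A a. I \<subseteq> A \<Longrightarrow> A \<subseteq> S \<Longrightarrow> a \<in> Sol A \<Longrightarrow> ev V f a = (0 :: 'f)"
  shows "invariant f"
  unfolding invariant_def
proof
  fix m assume m: "m \<in> \<X>"
  show "part m f \<in> null_polys (shifted m) (2 * e + h + 3)"
  proof (cases "\<exists>M. part m f M \<noteq> 0")
    case False
    then have "part m f = (\<lambda>_. 0)" by auto
    then show ?thesis by (simp add: null_polys.zero)
  next
    case True
    then obtain M0 where M0: "M0 \<inter> T = {}" "f (M0 \<triangle> m) \<noteq> 0"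
      by (auto simp: part_def split: if_splits)
    note m'' = X[OF M0(2)]
    define A where "A = tails \<sigma> m \<union> heads M0 \<union> I"
    have AS: "A \<subseteq> S" using I heads_S tails_S by (auto simp: A_def)
    have eq: "m \<triangle> (M0 \<triangle> m) = M0" by auto
    have "card (heads M0) \<le> h" using \<X>_heads[OF m m''] M0(1) unfolding eq by simp
    then have cA: "card A \<le> 2 * e + h + 3"
      unfolding A_def using card_Un3_le[of "tails \<sigma> m" "heads M0" I] \<X>_tails[OF m] I by linarith
    have "part m f \<in> ideal (shifted m) A"
      unfolding ideal_def
    proof (intro CollectI conjI allI impI ballI)
      fix M assume "part m f M \<noteq> 0"
      then have M: "M \<inter> T = {}" "f (M \<triangle> m) \<noteq> 0" by (auto simp: part_def split: if_splits)
      show "M \<subseteq> V - T" using \<X>_V[OF X[OF M(2)]] \<X>_V[OF m] M(1) by fastforce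
      have "(M \<triangle> m) \<triangle> (M0 \<triangle> m) \<subseteq> W" by (rule symdiff_subset[OF W[OF M(2)] W[OF M0(2)]])
      then have "heads ((M \<triangle> m) \<triangle> (M0 \<triangle> m)) \<subseteq> I" using heads_mono I by blast
      moreover have "((M \<triangle> m) \<triangle> (M0 \<triangle> m)) \<triangle> M0 = M" by auto
      ultimately have h: "heads M \<subseteq> I \<union> heads M0"
        using heads_symdiff[of "(M \<triangle> m) \<triangle> (M0 \<triangle> m)" M0] by auto
      have "tails \<sigma> (M \<triangle> m) \<subseteq> I"
      proof
        fix i assume "i \<in> tails \<sigma> (M \<triangle> m)"
        then obtain j where j: "i \<in> S" "j \<in> S" "(M \<triangle> m) \<inter> Bl i j = \<sigma> i j" by (auto simp: tails_def)
        then have "W \<inter> Bl i j \<noteq> {}" using \<sigma>_nonempty[of i j] W[OF M(2)] by blast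
        then show "i \<in> I" using I(4) j by blast
      qed
      then show "mention (shifted m) M \<subseteq> A" using h unfolding mention_shifted A_def by auto
    next
      fix a assume a: "a \<in> Sol A"
      show "ev V (part m f) a = 0"
        by (rule ev_part_zero[OF two \<X>_V[OF m]])
           (use zero[of A] Sol_T[OF a] AS in \<open>auto simp: A_def\<close>)
    qed
    then show ?thesis using null_ideal AS cA by blast
  qed
qed

text \<open>At base \<open>{}\<close> the part of \<open>1\<close> is \<open>1\<close> itself, and
  no reserved character within \<open>S\<close> is empty, so \<open>one_not_null\<close>
  applies.\<close>

lemma not_invariant_one:
  assumes "{} \<in> \<X>"
  shows "\<not> invariant (\<lambda>M. if M = {} then 1 else 0 :: 'f::field)"
proof
  let ?f = "\<lambda>M. if M = {} then 1 else 0 :: 'f"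
  assume "invariant ?f"
  moreover have "part {} ?f = ?f" by (auto simp: part_def)
  moreover have "shifted {} = \<sigma>" by (auto simp: shifted_def fun_eq_iff)
  ultimately have f: "?f \<in> null_polys \<sigma> (2 * e + h + 3)" using assms unfolding invariant_def by metis
  have t: "tails \<sigma> {} = {}" using \<sigma>_nonempty by (auto simp: tails_def)
  show False
    by (rule notE[OF one_not_null[OF \<sigma>_Bl _ t] f]) (use room in simp)
qed

end

section \<open>Polynomial calculus lines\<close>

definition oddset :: "('v \<Rightarrow>\<^sub>0 nat) \<Rightarrow> 'v set" where
  "oddset m = {v. odd (Poly_Mapping.lookup m v)}"

text \<open>The coefficient of the multilinear monomial \<open>M\<close> after reduction: exponent
  vectors that agree modulo 2 are merged. In this form the axioms \<open>var_poly v ^ 2 - 1\<close>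
  become zero.\<close>

definition mcoeff :: "('v, 'f::field) mpoly \<Rightarrow> 'v set \<Rightarrow> 'f" where
  "mcoeff p M = (\<Sum>m\<in>Poly_Mapping.keys p. if oddset m = M then Poly_Mapping.lookup p m else 0)"

lemma oddset_0 [simp]: "oddset 0 = {}"
  by (simp add: oddset_def)

lemma oddset_single: "oddset (Poly_Mapping.single v 1 + m) = oddset m \<triangle> {v}"
  by (auto simp: oddset_def lookup_add lookup_single when_def)

lemma oddset_mod: "oddset (Poly_Mapping.map (\<lambda>e. e mod 2) m) = oddset m"
  by (auto simp: oddset_def map.rep_eq when_def odd_pos)

lemma mcoeff_superset:
  assumes "finite K" "Poly_Mapping.keys p \<subseteq> K"
  shows "mcoeff p M = (\<Sum>m\<in>K. if oddset m = M then Poly_Mapping.lookup p m else 0)"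
  unfolding mcoeff_def
  by (rule sum.mono_neutral_left) (use assms in \<open>auto simp: in_keys_iff\<close>)

lemma mcoeff_zero [simp]: "mcoeff 0 = (\<lambda>_. 0)"
  by (auto simp: mcoeff_def)

lemma mcoeff_single: "mcoeff (Poly_Mapping.single m c) M = (if oddset m = M then c else 0)"
  by (subst mcoeff_superset[of "{m}"]) auto

lemma mcoeff_add: "mcoeff (p + q) M = mcoeff p M + mcoeff q M"
proof -
  let ?K = "Poly_Mapping.keys p \<union> Poly_Mapping.keys q"
  have "mcoeff (p + q) M = (\<Sum>m\<in>?K. if oddset m = M then Poly_Mapping.lookup (p + q) m else 0)"
    by (rule mcoeff_superset) (auto simp: keys_add)
  also have "\<dots> = (\<Sum>m\<in>?K. if oddset m = M then Poly_Mapping.lookup p m else 0) +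
                  (\<Sum>m\<in>?K. if oddset m = M then Poly_Mapping.lookup q m else 0)"
    unfolding sum.distrib[symmetric] by (rule sum.cong) (auto simp: lookup_add)
  also have "\<dots> = mcoeff p M + mcoeff q M"
    using mcoeff_superset[of ?K p M] mcoeff_superset[of ?K q M] by simp
  finally show ?thesis .
qed

lemma mcoeff_sum: "mcoeff (\<Sum>i\<in>I. f i) M = (\<Sum>i\<in>I. mcoeff (f i) M)"
  by (induction I rule: infinite_finite_induct) (auto simp: mcoeff_add)

lemma mcoeff_minus: "mcoeff (- p) M = - mcoeff p M"
  using mcoeff_add[of p "- p" M] by (simp add: eq_neg_iff_add_eq_0 add.commute)

lemma mcoeff_diff: "mcoeff (p - q) M = mcoeff p M - mcoeff q M"
  using mcoeff_add[of p "- q" M] by (simp add: mcoeff_minus)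

lemma mpoly_sum_monomials:
  "p = (\<Sum>m\<in>Poly_Mapping.keys p. Poly_Mapping.single m (Poly_Mapping.lookup p m))"
  by (rule poly_mapping_eqI) (simp add: lookup_sum lookup_single when_def in_keys_iff)

lemma mcoeff_const_mult: "mcoeff (const_poly c * p) M = c * mcoeff p M"
proof -
  have "const_poly c * p = (\<Sum>m\<in>Poly_Mapping.keys p. Poly_Mapping.single m (c * Poly_Mapping.lookup p m))"
    unfolding const_poly_def by (subst mpoly_sum_monomials[of p]) (simp add: sum_distrib_left mult_single)
  then have "mcoeff (const_poly c * p) M =
      (\<Sum>m\<in>Poly_Mapping.keys p. if oddset m = M then c * Poly_Mapping.lookup p m else 0)"
    by (simp add: mcoeff_sum mcoeff_single)
  then show ?thesis
    by (simp add: mcoeff_def sum_distrib_left if_distrib cong: if_cong)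
qed

lemma mcoeff_var_mult: "mcoeff (var_poly v * p) M = mcoeff p (M \<triangle> {v})"
proof -
  have "var_poly v * p = (\<Sum>m\<in>Poly_Mapping.keys p.
          Poly_Mapping.single (Poly_Mapping.single v 1 + m) (Poly_Mapping.lookup p m))"
    unfolding var_poly_def by (subst mpoly_sum_monomials[of p]) (simp add: sum_distrib_left mult_single)
  then have "mcoeff (var_poly v * p) M =
      (\<Sum>m\<in>Poly_Mapping.keys p. if oddset m \<triangle> {v} = M then Poly_Mapping.lookup p m else 0)"
    by (simp only: mcoeff_sum mcoeff_single oddset_single)
  moreover have "N \<triangle> {v} = M \<longleftrightarrow> N = M \<triangle> {v}" for N
    by (metis symdiff_cancel(1))
  ultimately show ?thesis by (simp add: mcoeff_def)
qed

lemma mcoeff_reduce: "mcoeff (reduce p) M = mcoeff p M"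
  by (simp add: reduce_def mcoeff_sum mcoeff_single oddset_mod) (simp add: mcoeff_def)

lemma mcoeff_one: "mcoeff 1 M = (if M = {} then 1 else 0)"
  using mcoeff_single[of 0 1 M] by (cases "M = {}") auto

lemma mcoeff_square: "mcoeff (var_poly v ^ 2 - 1) M = 0"
proof -
  have "mcoeff (var_poly v * (var_poly v * 1)) M = mcoeff 1 M"
    unfolding mcoeff_var_mult by simp
  then show ?thesis by (simp add: mcoeff_diff power2_eq_square)
qed

lemma finite_support_mcoeff: "finite {M. mcoeff p M \<noteq> 0}" (is ?fin)
  and card_support_mcoeff: "card {M. mcoeff p M \<noteq> 0} \<le> num_monomials p" (is ?card)
proof -
  have "M \<in> oddset ` Poly_Mapping.keys p" if "mcoeff p M \<noteq> 0" for M
  proof (rule ccontr)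
    assume "M \<notin> oddset ` Poly_Mapping.keys p"
    then have "mcoeff p M = 0" unfolding mcoeff_def by (intro sum.neutral) auto
    then show False using that by simp
  qed
  then have *: "{M. mcoeff p M \<noteq> 0} \<subseteq> oddset ` Poly_Mapping.keys p" by auto
  show ?fin by (rule finite_subset[OF *]) simp
  show ?card
    unfolding num_monomials_def
    using card_mono[OF _ *] card_image_le[of "Poly_Mapping.keys p" oddset] by simp
qed

section \<open>Clause polynomials: zeros and supports\<close>

fun lit_var :: "'v literal \<Rightarrow> 'v" where
  "lit_var (Pos v) = v"
| "lit_var (Neg v) = v"

fun lit_true :: "'v set \<Rightarrow> 'v literal \<Rightarrow> bool" where
  "lit_true a (Pos v) \<longleftrightarrow> v \<in> a"
| "lit_true a (Neg v) \<longleftrightarrow> v \<notin> a"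

lemma mcoeff_literal_mult:
  "mcoeff (literal_poly x * p) M =
     mcoeff p M + (case x of Pos _ \<Rightarrow> 1 | Neg _ \<Rightarrow> - 1) * mcoeff p (M \<triangle> {lit_var x})"
  by (cases x) (simp_all add: distrib_right left_diff_distrib mcoeff_add mcoeff_diff mcoeff_var_mult)

lemma ev_literal_mult:
  assumes "finite V" "lit_var x \<in> V" "lit_true a x"
  shows "ev V (mcoeff (literal_poly x * p)) a = 0"
proof -
  have "ev V (mcoeff (literal_poly x * p)) a =
      (1 + (case x of Pos _ \<Rightarrow> 1 | Neg _ \<Rightarrow> - 1) * chi {lit_var x} a) * ev V (mcoeff p) a"
    unfolding mcoeff_literal_mult[abs_def] ev_add ev_cmult
    using assms by (subst ev_shift) (auto simp: algebra_simps)
  then show ?thesis using assms(3) by (cases x) (auto simp: chi_def)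
qed

lemma mcoeff_clause_poly: "mcoeff (clause_poly C) M = mcoeff (\<Prod>x\<in>C. literal_poly x) M"
  by (simp add: clause_poly_def mcoeff_reduce)

lemma ev_clause_poly:
  assumes "finite V" "finite C" "lit_var ` C \<subseteq> V" "\<exists>x\<in>C. lit_true a x"
  shows "ev V (mcoeff (clause_poly C)) a = (0 :: 'f::field)"
proof -
  obtain x where x: "x \<in> C" "lit_true a x" using assms by auto
  have "(\<Prod>x\<in>C. literal_poly x :: ('a, 'f) mpoly) = literal_poly x * (\<Prod>y\<in>C - {x}. literal_poly y)"
    using assms x by (simp add: prod.remove)
  then show ?thesis
    unfolding mcoeff_clause_poly[abs_def]
    using ev_literal_mult[of V x a "\<Prod>y\<in>C - {x}. literal_poly y :: ('a, 'f) mpoly"] assms(1,3) x by auto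
qed

lemma clause_poly_support:
  assumes "finite C" "mcoeff (clause_poly C :: ('v, 'f::field) mpoly) M \<noteq> 0"
  shows "M \<subseteq> lit_var ` C"
  using assms(1) assms(2)[unfolded mcoeff_clause_poly]
proof (induction C arbitrary: M rule: finite_induct)
  case empty
  then show ?case by (simp add: mcoeff_one split: if_splits)
next
  case (insert x C)
  let ?p = "\<Prod>y\<in>C. literal_poly y :: ('v, 'f) mpoly"
  have "mcoeff ?p M \<noteq> 0 \<or> mcoeff ?p (M \<triangle> {lit_var x}) \<noteq> 0"
    using insert by (auto simp: mcoeff_literal_mult)
  then have "M \<subseteq> lit_var ` C \<or> M \<triangle> {lit_var x} \<subseteq> lit_var ` C"
    using insert.IH by blast
  then show ?case by auto
qed

section \<open>Induction along the lines of a refutation\<close>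

context pc_worlds
begin

lemma no_refutation:
  assumes two: "(2 :: 'f::field) \<noteq> 0"
    and R: "pc_refutation U (clause_poly ` F) (R :: ('v, 'f) mpoly list)"
    and X: "\<And>p M. p \<in> set R \<Longrightarrow> mcoeff p M \<noteq> 0 \<Longrightarrow> M \<in> \<X>"
    and F: "\<And>C. C \<in> F \<Longrightarrow> finite C \<and> lit_var ` C \<subseteq> V"
    and I: "\<And>C. C \<in> F \<Longrightarrow> \<exists>I\<subseteq>S. card I \<le> 3 \<and> heads (lit_var ` C) \<subseteq> I \<and>
       (\<forall>i\<in>S. \<forall>j\<in>S. lit_var ` C \<inter> Bl i j \<noteq> {} \<longrightarrow> i \<in> I) \<and>
       (\<forall>A a. I \<subseteq> A \<longrightarrow> A \<subseteq> S \<longrightarrow> a \<in> Sol A \<longrightarrow> (\<exists>x\<in>C. lit_true a x))"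
  shows False
proof -
  have inv: "invariant (mcoeff (R ! r))" if "r < length R" for r
    using that
  proof (induction r rule: less_induct)
    case (less r)
    have inX: "M \<in> \<X>" if "mcoeff (R ! q) M \<noteq> 0" "q \<le> r" for q M
      using X[of "R ! q"] that less.prems by auto
    from R less.prems consider
        (ax) "R ! r \<in> clause_poly ` F"
      | (sq) v where "R ! r = var_poly v ^ 2 - 1"
      | (lin) p q \<alpha> \<beta> where "p < r" "q < r" "R ! r = const_poly \<alpha> * R ! p + const_poly \<beta> * R ! q"
      | (var) p v where "p < r" "R ! r = reduce (var_poly v * R ! p)"
      unfolding pc_refutation_def by blast
    then show ?case
    proof cases
      case ax
      then obtain C where C: "C \<in> F" "R ! r = clause_poly C" by auto
      obtain I where I: "I \<subseteq> S" "card I \<le> 3" "heads (lit_var ` C) \<subseteq> I"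
       "\<forall>i\<in>S. \<forall>j\<in>S. lit_var ` C \<inter> Bl i j \<noteq> {} \<longrightarrow> i \<in> I"
       "\<forall>A a. I \<subseteq> A \<longrightarrow> A \<subseteq> S \<longrightarrow> a \<in> Sol A \<longrightarrow> (\<exists>x\<in>C. lit_true a x)"
        using I[OF C(1)] by blast
      show ?thesis
      proof (rule invariant_axiom[OF two _ _ I(1-3)])
        show "M \<in> \<X>" if "mcoeff (R ! r) M \<noteq> 0" for M using inX[OF that] by simp
        show "M \<subseteq> lit_var ` C" if "mcoeff (R ! r) M \<noteq> 0" for M
          using that C F clause_poly_support by metis
        show "i \<in> I" if "i \<in> S" "j \<in> S" "lit_var ` C \<inter> Bl i j \<noteq> {}" for i j
          using I(4) that by blast
        show "ev V (mcoeff (R ! r)) a = 0" if "I \<subseteq> A" "A \<subseteq> S" "a \<in> Sol A" for A a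
          unfolding C(2) by (rule ev_clause_poly) (use finV F[OF C(1)] I(5) that in auto)
      qed
    next
      case sq
      then have "mcoeff (R ! r) = (\<lambda>_. 0)" by (auto simp: mcoeff_square)
      then show ?thesis using invariant_zero by metis
    next
      case lin
      have "mcoeff (R ! r) = (\<lambda>M. \<alpha> * mcoeff (R ! p) M + \<beta> * mcoeff (R ! q) M)"
        using lin by (auto simp: mcoeff_add mcoeff_const_mult)
      moreover have "invariant (mcoeff (R ! p))" "invariant (mcoeff (R ! q))"
        using less lin by auto
      ultimately show ?thesis using invariant_comb by simp
    next
      case var
      have eq: "mcoeff (R ! r) = (\<lambda>M. mcoeff (R ! p) (M \<triangle> {v}))"
        using var by (auto simp: mcoeff_reduce mcoeff_var_mult)
      show ?thesis unfolding eq
        by (rule invariant_var) (use inX[of r, unfolded eq] inX[of p] var less in auto)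
    qed
  qed
  have R': "R \<noteq> []" "last R = 1" using R by (auto simp: pc_refutation_def)
  then have one: "invariant (mcoeff (1 :: ('v, 'f) mpoly))"
    using inv[of "length R - 1"] by (simp add: last_conv_nth)
  have "{} \<in> \<X>"
    using X[of 1 "{}"] R' by (metis mcoeff_one last_in_set zero_neq_one)
  then show False
    by (rule notE[OF not_invariant_one one[unfolded mcoeff_one[abs_def]]])
qed

end

lemma refutation_support:
  assumes R: "pc_refutation V (clause_poly ` F) (R :: ('v, 'f::field) mpoly list)"
    and F: "\<And>C. C \<in> F \<Longrightarrow> finite C \<and> lit_var ` C \<subseteq> V"
    and r: "r < length R" "mcoeff (R ! r) M \<noteq> 0"
  shows "M \<subseteq> V"
  using r
proof (induction r arbitrary: M rule: less_induct)
  case (less r)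
  from R less.prems(1) consider
      (ax) "R ! r \<in> clause_poly ` F"
    | (sq) v where "R ! r = var_poly v ^ 2 - 1"
    | (lin) p q \<alpha> \<beta> where "p < r" "q < r" "R ! r = const_poly \<alpha> * R ! p + const_poly \<beta> * R ! q"
    | (var) p v where "p < r" "v \<in> V" "R ! r = reduce (var_poly v * R ! p)"
    unfolding pc_refutation_def by blast
  then show ?case
  proof cases
    case ax
    then obtain C where "C \<in> F" "R ! r = clause_poly C" by auto
    then show ?thesis using less.prems(2) F clause_poly_support by (metis subset_trans)
  next
    case sq
    then show ?thesis using less.prems by (simp add: mcoeff_square)
  next
    case lin
    then have "mcoeff (R ! p) M \<noteq> 0 \<or> mcoeff (R ! q) M \<noteq> 0"
      using less.prems by (auto simp: mcoeff_add mcoeff_const_mult)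
    then show ?thesis using less lin by (metis less_trans)
  next
    case var
    then have "M \<triangle> {v} \<subseteq> V"
      using less.IH[of p "M \<triangle> {v}"] less.prems by (simp add: mcoeff_reduce mcoeff_var_mult)
    then show ?thesis using var by auto
  qed
qed

text \<open>A nonzero line with a single monomial cannot be an axiom, so size one is not enough to refute.\<close>

lemma pc_size_ge_2:
  assumes R: "pc_refutation U (clause_poly ` F) (R :: ('v, 'f::field) mpoly list)"
    and F: "\<And>C. C \<in> F \<Longrightarrow> finite C \<and> C \<noteq> {}"
  shows "pc_size R \<ge> 2"
proof (rule ccontr)
  assume "\<not> ?thesis"
  then have sz: "pc_size R \<le> 1" by simp
  have R': "R \<noteq> []" "last R = 1" using R by (auto simp: pc_refutation_def)
  have le1: "num_monomials p \<le> 1" if "p \<in> set R" for p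
    using sz member_le_sum_list[of "num_monomials p" "map num_monomials R"] that by (simp add: pc_size_def)
  have nz: "\<exists>M. mcoeff p M \<noteq> 0" if p: "p \<in> set R" "p \<noteq> 0" for p
  proof -
    have "card (Poly_Mapping.keys p) = 1"
      using le1[OF p(1)] p(2) by (cases "card (Poly_Mapping.keys p)") (auto simp: num_monomials_def)
    then obtain m where m: "Poly_Mapping.keys p = {m}" by (auto simp: card_1_singleton_iff)
    then have "mcoeff p (oddset m) = Poly_Mapping.lookup p m" by (simp add: mcoeff_def)
    moreover have "Poly_Mapping.lookup p m \<noteq> 0" using m by (simp flip: in_keys_iff)
    ultimately show ?thesis by metis
  qed
  have uniq: "M = N" if "p \<in> set R" "mcoeff p M \<noteq> 0" "mcoeff p N \<noteq> 0" for p M N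
    using that le1[of p] card_support_mcoeff[of p]
      card_le_Suc0_iff_eq[OF finite_support_mcoeff[of p]] by simp
  have zero: "R ! r = 0" if "r < length R" for r
    using that
  proof (induction r rule: less_induct)
    case (less r)
    have inR: "R ! r \<in> set R" using less.prems by simp
    from R less.prems consider
        (ax) "R ! r \<in> clause_poly ` F"
      | (sq) v where "R ! r = var_poly v ^ 2 - 1"
      | (lin) p q \<alpha> \<beta> where "p < r" "q < r" "R ! r = const_poly \<alpha> * R ! p + const_poly \<beta> * R ! q"
      | (var) p v where "p < r" "R ! r = reduce (var_poly v * R ! p)"
      unfolding pc_refutation_def by blast
    then show ?case
    proof cases
      case ax
      then obtain C where C: "C \<in> F" "R ! r = clause_poly C" by auto
      then have fC: "finite C" "C \<noteq> {}" using F by auto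
      then obtain x where x: "x \<in> C" by auto
      \<comment> \<open>The clause is nonempty, so some assignment makes it true and its polynomial
        zero, whereas a single monomial with nonzero coefficient never evaluates to zero.\<close>
      define a where "a = (case x of Pos v \<Rightarrow> {v} | Neg v \<Rightarrow> {})"
      have "lit_true a x" by (cases x) (auto simp: a_def)
      then have ev0: "ev (lit_var ` C) (mcoeff (R ! r)) a = 0"
        unfolding C(2) using fC x by (intro ev_clause_poly) auto
      show ?thesis
      proof (rule ccontr)
        assume "R ! r \<noteq> 0"
        then obtain M where M: "mcoeff (R ! r) M \<noteq> 0" using nz inR by blast
        then have "M \<subseteq> lit_var ` C" using clause_poly_support[of C M] fC C by simp
        then have "ev (lit_var ` C) (mcoeff (R ! r)) a = (\<Sum>N\<in>{M}. mcoeff (R ! r) N * chi N a)"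
          unfolding ev_def by (intro sum.mono_neutral_right) (use fC uniq[OF inR M] in auto)
        then show False using ev0 M by simp
      qed
    next
      case sq
      then have "mcoeff (R ! r) M = 0" for M by (simp add: mcoeff_square)
      then show ?thesis using nz inR by blast
    next
      case lin
      then show ?thesis using less by simp
    next
      case var
      then have "R ! p = 0" using less by simp
      then show ?thesis using var by (simp add: reduce_def)
    qed
  qed
  then show False
    using R' zero[of "length R - 1"] by (simp add: last_conv_nth)
qed

section \<open>Local worlds for the ordering principle\<close>

text \<open>For \<open>j\<close> outside \<open>S\<close>, \<open>B j\<close> contains the bits of
  the pointer of \<open>j\<close> that are split. By \<open>cover\<close>, each \<open>i\<close>
  outside \<open>S\<close> has a digit 1 at a bit that is not split; as these bits are set to 0,
  \<open>j\<close> never points to \<open>i\<close>.\<close>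

locale bop_split =
  fixes n k l :: nat and S :: "nat set" and B :: "nat \<Rightarrow> nat set"
  assumes n: "n = 2 ^ k" and S: "S \<subseteq> {..<n}" and B: "B j \<subseteq> {1..k}"
    and cover: "i < n \<Longrightarrow> i \<notin> S \<Longrightarrow> \<exists>b\<in>{1..k} - B j. bit i (b - 1)"
begin

definition T :: "bop_var set" where
  "T = {X i j m | i j m. i \<in> S \<and> j \<in> {..<n} - S \<and> m \<in> {2..l}} \<union>
       {Y j b | j b. j \<in> {..<n} - S \<and> b \<in> B j}"

text \<open>The index 1 is left out: the variable \<open>X i j 1\<close> is constant, false inside
  \<open>S\<close> and true from \<open>S\<close> to the outside, where it satisfies the disjunction
  whatever the split variables are.\<close>

definition Bl :: "nat \<Rightarrow> nat \<Rightarrow> bop_var set" where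
  "Bl i j = X i j ` {2..l}"

definition Yv :: "nat \<Rightarrow> bop_var set" where
  "Yv j = Y j ` {1..k}"

lemma mem_Bl [simp]: "X i j m \<in> Bl i' j' \<longleftrightarrow> i = i' \<and> j = j' \<and> m \<in> {2..l}" "Y j b \<notin> Bl i' j'"
  by (auto simp: Bl_def)

lemma mem_Yv [simp]: "Y j b \<in> Yv j' \<longleftrightarrow> j = j' \<and> b \<in> {1..k}" "X i j m \<notin> Yv j'"
  by (auto simp: Yv_def)

text \<open>
  The elements outside \<open>S\<close> form an antichain above \<open>S\<close>, and each of them points into \<open>S\<close> whatever
  the values of its split bits are.
\<close>

definition fixed :: "bop_var set \<Rightarrow> bool" where
  "fixed a \<longleftrightarrow> (\<forall>i\<in>S. \<forall>j\<in>S. X i j 1 \<notin> a) \<and> (\<forall>i\<in>S. \<forall>m. X i i m \<notin> a) \<and>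
     (\<forall>i\<in>S. \<forall>j\<in>{..<n} - S. X i j 1 \<in> a) \<and> (\<forall>i\<in>{..<n} - S. \<forall>j m. X i j m \<notin> a) \<and>
     (\<forall>j\<in>{..<n} - S. \<forall>b\<in>{1..k} - B j. Y j b \<notin> a)"

definition lt :: "bop_var set \<Rightarrow> nat \<Rightarrow> nat \<Rightarrow> bool" where
  "lt a i j \<longleftrightarrow> a \<inter> Bl i j \<noteq> {}"

definition pts :: "bop_var set \<Rightarrow> nat \<Rightarrow> nat \<Rightarrow> bool" where
  "pts a j i \<longleftrightarrow> (\<forall>b\<in>{1..k}. Y j b \<in> a \<longleftrightarrow> bit i (b - 1))"

text \<open>Inside \<open>A\<close> the relation must be transitive and agree with the pointers. A
  pointer may lead to an element of \<open>S\<close> outside \<open>A\<close>, which imposes no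
  further constraint; this is what allows elements to be forgotten.\<close>

definition Sol :: "nat set \<Rightarrow> bop_var set set" where
  "Sol A = {a. A \<subseteq> S \<and> fixed a \<and>
     (\<forall>i\<in>A. \<forall>j\<in>A. \<forall>p\<in>A. lt a i j \<longrightarrow> lt a j p \<longrightarrow> lt a i p) \<and>
     (\<forall>j\<in>A. \<forall>i<n. pts a j i \<longrightarrow> i \<in> S \<and> (i \<in> A \<longrightarrow> lt a i j))}"

lemma lt_iff: "lt a i j \<longleftrightarrow> (\<exists>m\<in>{2..l}. X i j m \<in> a)"
  unfolding lt_def Bl_def by blast

lemma floor_log_n: "floor_log n = k"
  by (simp add: n)

lemma finite_bop_vars: "finite (bop_vars l n)"
proof -
  have "bop_vars l n \<subseteq> (\<lambda>(i, j, m). X i j m) ` ({..<n} \<times> {..<n} \<times> {1..l}) \<union>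
      (\<lambda>(j, a). Y j a) ` ({..<n} \<times> {1..floor_log n})"
    by (auto simp: bop_vars_def image_iff)
  then show ?thesis by (rule finite_subset) auto
qed

lemma lt_cong: "a \<inter> Bl i j = a' \<inter> Bl i j \<Longrightarrow> lt a i j = lt a' i j"
  by (simp add: lt_def)

lemma pts_cong: "a \<inter> Yv j = a' \<inter> Yv j \<Longrightarrow> pts a j i = pts a' j i"
  unfolding pts_def Yv_def by (intro ball_cong) auto

lemma pts_unique:
  assumes "pts a j i" "pts a j i'" "i < n" "i' < n"
  shows "i = i'"
proof (rule bit_eqI)
  fix b
  show "bit i b = bit i' b"
  proof (cases "b < k")
    case True
    then have "Suc b \<in> {1..k}" by auto
    then show ?thesis using assms(1,2) unfolding pts_def by (metis diff_Suc_1)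
  next
    case False
    have "\<not> bit x b" if "x < n" for x
    proof -
      have "x < 2 ^ b"
        using that False n by (meson less_le_trans not_less one_le_numeral power_increasing)
      then show ?thesis by (simp add: bit_nat_def)
    qed
    then show ?thesis using assms(3,4) by simp
  qed
qed

text \<open>An element \<open>t\<close> of \<open>S\<close> outside \<open>A\<close> exists by the
  cardinalities. Pointing \<open>z\<close> at \<open>t\<close> and emptying the blocks into
  \<open>z\<close> makes \<open>z\<close> a minimum of \<open>A\<close>, given that its blocks into
  the rest are nonempty: the pointer is unconstrained within \<open>A\<close>, and transitivity is
  preserved.\<close>

lemma extend:
  assumes A: "A \<subseteq> S" "z \<in> A" "card A < card S"
  shows "\<exists>h. h \<subseteq> Yv z \<union> (\<Union>i\<in>S - {z}. Bl i z) \<and>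
            (\<forall>a\<in>Sol (A - {z}). (\<forall>j\<in>A - {z}. a \<inter> Bl z j \<noteq> {}) \<longrightarrow>
               (a - (Yv z \<union> (\<Union>i\<in>S - {z}. Bl i z))) \<union> h \<in> Sol A)"
proof -
  have "\<not> S \<subseteq> A"
    using A(1,3) by auto
  then obtain t where t: "t \<in> S" "t \<notin> A"
    by auto
  let ?H = "Yv z \<union> (\<Union>i\<in>S - {z}. Bl i z)"
  let ?h = "Y z ` {b \<in> {1..k}. bit t (b - 1)}"
  have "?h \<subseteq> ?H" by (auto simp: Yv_def)
  moreover have "(a - ?H) \<union> ?h \<in> Sol A"
    if a: "a \<in> Sol (A - {z})" and ne: "\<forall>j\<in>A - {z}. a \<inter> Bl z j \<noteq> {}" for a
  proof -
    let ?a = "(a - ?H) \<union> ?h"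
    have fx: "fixed a" using a by (simp add: Sol_def)
    have tr: "lt a i p" if "i \<in> A - {z}" "j \<in> A - {z}" "p \<in> A - {z}" "lt a i j" "lt a j p" for i j p
      using a that unfolding Sol_def by blast
    have pt: "i \<in> S \<and> (i \<in> A - {z} \<longrightarrow> lt a i j)" if "j \<in> A - {z}" "i < n" "pts a j i" for i j
      using a that unfolding Sol_def by blast
    have zS: "z \<in> S" "z < n" using A S by auto
    have X: "X i j m \<in> ?a \<longleftrightarrow> X i j m \<in> a \<and> \<not> (j = z \<and> i \<in> S - {z} \<and> m \<in> {2..l})" for i j m
      by auto
    have Y: "\<forall>j\<in>{..<n} - S. \<forall>b\<in>{1..k} - B j. Y j b \<notin> ?a"
      using fx zS unfolding fixed_def by auto
    have fx': "fixed ?a"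
      unfolding fixed_def X using fx Y unfolding fixed_def by auto
    have ltz: "\<not> lt ?a i z" if "i \<in> A" for i
    proof (cases "i = z")
      case True
      then have "a \<inter> Bl i z = {}" using fx zS by (auto simp: fixed_def Bl_def)
      then show ?thesis by (auto simp: lt_def Bl_def)
    next
      case False
      then show ?thesis using that A by (auto simp: lt_def Bl_def)
    qed
    have lt_eq: "lt ?a i j = lt a i j" if "j \<noteq> z" for i j
      by (rule lt_cong) (use that in \<open>auto simp: Bl_def Yv_def\<close>)
    have pts_eq: "pts ?a j i = pts a j i" if "j \<noteq> z" for i j
      by (rule pts_cong) (use that in \<open>auto simp: Bl_def Yv_def\<close>)
    have "pts ?a z t" by (auto simp: pts_def Yv_def)
    then have ptz: "i = t" if "pts ?a z i" "i < n" for i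
      using pts_unique that t S by blast
    have R1: "lt ?a i p" if ijp: "i \<in> A" "j \<in> A" "p \<in> A" "lt ?a i j" "lt ?a j p" for i j p
    proof -
      have jp: "j \<noteq> z" "p \<noteq> z" using ltz[OF ijp(1)] ltz[OF ijp(2)] ijp(4,5) by auto
      show ?thesis
      proof (cases "i = z")
        case True
        then show ?thesis using ne ijp jp lt_eq[of p z] by (auto simp: lt_def)
      next
        case False
        then show ?thesis using tr[of i j p] ijp jp lt_eq by auto
      qed
    qed
    have R2: "i \<in> S \<and> (i \<in> A \<longrightarrow> lt ?a i j)" if ji: "j \<in> A" "i < n" "pts ?a j i" for i j
    proof (cases "j = z")
      case True
      then show ?thesis using ptz ji t by auto
    next
      case False
      then have "i \<in> S \<and> (i \<in> A - {z} \<longrightarrow> lt a i j)" using pt[of j i] ji pts_eq by auto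
      then show ?thesis using False ne ji lt_eq[of j] by (auto simp: lt_def)
    qed
    show ?thesis
      unfolding Sol_def mem_Collect_eq
      by (intro conjI ballI allI impI) (fact A(1), fact fx', fact R1, use R2 in blast, use R2 in blast)
  qed
  ultimately show ?thesis by blast
qed

sublocale local_worlds "bop_vars l n" T S Bl Yv Sol
proof unfold_locales
  show "finite (bop_vars l n)" by (rule finite_bop_vars)
  show "finite S" using S finite_subset by blast
  show "Bl i j \<subseteq> bop_vars l n - T" if "i \<in> S" "j \<in> S" for i j
    using that S by (auto simp: Bl_def bop_vars_def T_def)
  show "Yv j \<subseteq> bop_vars l n - T" if "j \<in> S" for j
    using that S by (auto simp: Yv_def bop_vars_def T_def floor_log_n)
  show "Bl i j \<inter> Bl i' j' = {}" if "(i, j) \<noteq> (i', j')" for i j i' j'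
    using that by (auto simp: Bl_def)
  show "Yv j \<inter> Yv j' = {}" if "j \<noteq> j'" for j j'
    using that by (auto simp: Yv_def)
  show "Yv j \<inter> Bl i' j' = {}" for j i' j'
    by (auto simp: Yv_def Bl_def)
  show "Sol A' \<subseteq> Sol A" if "A \<subseteq> A'" for A A'
  proof
    fix a assume "a \<in> Sol A'"
    then show "a \<in> Sol A"
      using that unfolding Sol_def mem_Collect_eq
      by (elim conjE, intro conjI ballI allI impI) blast+
  qed
  show "a - Bl z j \<union> P \<in> Sol A" if "A \<subseteq> S" "z \<in> S - A" "j \<in> A" "a \<in> Sol A" "P \<subseteq> Bl z j" for A z j a P
  proof -
    define a' where "a' = a - Bl z j \<union> P"
    have "fixed a" using that by (simp add: Sol_def)
    have X: "X i' j' m \<in> a' \<longleftrightarrow> X i' j' m \<in> a" if "\<not> (i' = z \<and> j' = j \<and> m \<in> {2..l})" for i' j' m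
    proof -
      have "X i' j' m \<notin> Bl z j" using that by auto
      then have "X i' j' m \<notin> P" using \<open>P \<subseteq> Bl z j\<close> by blast
      then show ?thesis using \<open>X i' j' m \<notin> Bl z j\<close> by (simp add: a'_def)
    qed
    have Y: "Y j' b \<in> a' \<longleftrightarrow> Y j' b \<in> a" for j' b
    proof -
      have "Y j' b \<notin> Bl z j" by simp
      then have "Y j' b \<notin> P" using \<open>P \<subseteq> Bl z j\<close> by blast
      then show ?thesis by (simp add: a'_def)
    qed
    have zj: "z \<in> S" "j \<in> S" "z \<noteq> j" using that by auto
    then have ne: "i \<noteq> z" if "i \<notin> S" for i using that by auto
    have "fixed a'"
      using \<open>fixed a\<close> zj ne unfolding fixed_def Y by (simp add: X)
    moreover have "lt a' i' j' = lt a i' j'" if "i' \<in> A" for i' j'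
      by (rule lt_cong) (use that \<open>z \<in> S - A\<close> \<open>P \<subseteq> Bl z j\<close> in \<open>auto simp: a'_def Bl_def\<close>)
    moreover have "pts a' j' i' = pts a j' i'" for i' j'
      by (rule pts_cong) (use \<open>P \<subseteq> Bl z j\<close> in \<open>auto simp: a'_def Bl_def Yv_def\<close>)
    ultimately have "a' \<in> Sol A \<longleftrightarrow> a \<in> Sol A"
      unfolding Sol_def mem_Collect_eq using \<open>fixed a\<close> by simp
    then show ?thesis using \<open>a \<in> Sol A\<close> unfolding a'_def by blast
  qed
  show "\<exists>h. h \<subseteq> Yv z \<union> (\<Union>i\<in>S - {z}. Bl i z) \<and>
            (\<forall>a\<in>Sol (A - {z}). (\<forall>j\<in>A - {z}. a \<inter> Bl z j \<noteq> {}) \<longrightarrow>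
               (a - (Yv z \<union> (\<Union>i\<in>S - {z}. Bl i z))) \<union> h \<in> Sol A)"
    if "A \<subseteq> S" "z \<in> A" "card A < card S" for A z
    by (rule extend[OF that])
  have "{X i j 1 | i j. i \<in> S \<and> j \<in> {..<n} - S} \<in> Sol {}"
    by (auto simp: Sol_def fixed_def)
  then show "Sol {} \<noteq> {}" by blast
  show "T \<subseteq> bop_vars l n"
    using S B by (fastforce simp: T_def bop_vars_def floor_log_n)
  show "a - T \<union> P \<in> Sol A" if "a \<in> Sol A" "P \<subseteq> T" for a A P
  proof -
    define a' where "a' = a - T \<union> P"
    have AS: "A \<subseteq> S" and "fixed a" using that by (auto simp: Sol_def)
    \<comment> \<open>The right-hand side is nonempty only under the index conditions for split
      variables; it states these conditions in one formula for both constructors.\<close>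
    have T': "x \<in> T \<Longrightarrow> x \<in> (case x of X i j m \<Rightarrow> if i \<in> S \<and> j \<notin> S \<and> m \<ge> 2 then {x} else {}
          | Y j b \<Rightarrow> if j \<notin> S \<and> b \<in> B j then {x} else {})" for x
      by (auto simp: T_def)
    have X: "X i j m \<in> a' \<longleftrightarrow> X i j m \<in> a" if "i \<notin> S \<or> j \<in> S \<or> m < 2" for i j m
      using that \<open>P \<subseteq> T\<close> T'[of "X i j m"] by (auto simp: a'_def split: if_splits)
    have Y: "Y j b \<in> a' \<longleftrightarrow> Y j b \<in> a" if "j \<in> S \<or> b \<notin> B j" for j b
      using that \<open>P \<subseteq> T\<close> T'[of "Y j b"] by (auto simp: a'_def split: if_splits)
    have "fixed a'"
      using \<open>fixed a\<close> unfolding fixed_def by (simp add: X Y)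
    moreover have lt: "lt a' i j = lt a i j" if "j \<in> A" for i j
      by (rule lt_cong) (use X[of i j] that AS in \<open>auto simp: Bl_def\<close>)
    moreover have "pts a' j i = pts a j i" if "j \<in> A" for i j
      unfolding pts_def using Y AS that by auto
    ultimately have "a' \<in> Sol A \<longleftrightarrow> a \<in> Sol A"
      unfolding Sol_def mem_Collect_eq using \<open>fixed a\<close> by simp
    then show ?thesis using \<open>a \<in> Sol A\<close> unfolding a'_def by blast
  qed
qed

text \<open>\<open>I\<close> consists of the indices of the clause that lie in \<open>S\<close>. If
  an index is outside \<open>S\<close>, the clause is true because a relation from outside
  \<open>S\<close> is false, a relation from \<open>S\<close> to the outside is true, or the pointer
  in question does not lead outside \<open>S\<close>. If all indices are in \<open>S\<close>, the
  conditions of \<open>Sol A\<close> apply.\<close>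

lemma clause_true:
  assumes l: "l \<ge> 2" and C: "C \<in> BOP_or l n"
  shows "finite C \<and> lit_var ` C \<subseteq> bop_vars l n \<and> (\<exists>I\<subseteq>S. card I \<le> 3 \<and> heads (lit_var ` C) \<subseteq> I \<and>
       (\<forall>i\<in>S. \<forall>j\<in>S. lit_var ` C \<inter> Bl i j \<noteq> {} \<longrightarrow> i \<in> I) \<and>
       (\<forall>A a. I \<subseteq> A \<longrightarrow> A \<subseteq> S \<longrightarrow> a \<in> Sol A \<longrightarrow> (\<exists>x\<in>C. lit_true a x)))"
proof -
  have index: "\<exists>I\<subseteq>S. card I \<le> 3 \<and> heads (lit_var ` C) \<subseteq> I \<and>
       (\<forall>i\<in>S. \<forall>j\<in>S. lit_var ` C \<inter> Bl i j \<noteq> {} \<longrightarrow> i \<in> I) \<and>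
       (\<forall>A a. I \<subseteq> A \<longrightarrow> A \<subseteq> S \<longrightarrow> a \<in> Sol A \<longrightarrow> (\<exists>x\<in>C. lit_true a x))"
    if J: "\<And>i j m. X i j m \<in> lit_var ` C \<Longrightarrow> i \<in> J \<and> j \<in> J" "\<And>j b. Y j b \<in> lit_var ` C \<Longrightarrow> j \<in> J"
      "card J \<le> 3" "finite J" and "\<And>A a. J \<inter> S \<subseteq> A \<Longrightarrow> a \<in> Sol A \<Longrightarrow> \<exists>x\<in>C. lit_true a x" for J
  proof (intro exI[of _ "J \<inter> S"] conjI ballI impI allI)
    show "card (J \<inter> S) \<le> 3" using card_mono[of J "J \<inter> S"] J by auto
    show "heads (lit_var ` C) \<subseteq> J \<inter> S"
    proof
      fix j assume "j \<in> heads (lit_var ` C)"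
      then obtain v where v: "j \<in> S" "v \<in> lit_var ` C" "v \<in> Hd j" by (auto simp: heads_def)
      then have "j \<in> J" using J(1,2) by (cases v) (auto simp: Hd_def)
      then show "j \<in> J \<inter> S" using v(1) by simp
    qed
    show "i \<in> J \<inter> S" if "i \<in> S" "j \<in> S" "lit_var ` C \<inter> Bl i j \<noteq> {}" for i j
    proof -
      obtain v where v: "v \<in> lit_var ` C" "v \<in> Bl i j" using \<open>lit_var ` C \<inter> Bl i j \<noteq> {}\<close> by blast
      then have "i \<in> J" using J(1) by (cases v) auto
      then show ?thesis using \<open>i \<in> S\<close> by simp
    qed
  qed (use that in auto)
  have or1: "\<exists>x\<in>or_clause l i j. lit_true a x" if "i \<in> S" "j \<in> {..<n} - S" "fixed a" for i j a
  proof -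
    have "X i j 1 \<in> a" using that by (auto simp: fixed_def)
    moreover have "Pos (X i j 1) \<in> or_clause l i j" using l by (auto simp: or_clause_def)
    ultimately show ?thesis by force
  qed
  have or2: "\<exists>x\<in>or_clause l i j. lit_true a x" if ij: "lt a i j" for i j a
  proof -
    obtain m where "m \<in> {2..l}" "X i j m \<in> a" using ij unfolding lt_iff by blast
    then show ?thesis by (intro bexI[of _ "Pos (X i j m)"]) (auto simp: or_clause_def)
  qed
  have lt: "lt a i j" if "X i j m \<in> a" "i \<in> S" "j \<in> S" "fixed a" "m \<in> {1..l}" for a i j m
  proof -
    have "m \<noteq> 1" using that by (auto simp: fixed_def)
    then show ?thesis using that by (auto simp: lt_iff)
  qed
  have inS: "i \<in> S" if "X i j m \<in> a" "i < n" "fixed a" for a i j m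
    using that unfolding fixed_def by blast
  have irrefl: "\<not> lt a i i" if "i \<in> S" "fixed a" for a i
    using that by (auto simp: lt_iff fixed_def)
  have finite_or: "finite (or_clause l i j)" for i j
    by (simp add: or_clause_def Setcompr_eq_image)
  show ?thesis
    using C unfolding BOP_or_def Un_iff mem_Collect_eq
  proof (elim disjE exE conjE)
    fix i j assume ptr: "C = neq_clause n j i \<union> or_clause l i j" "i < n" "j < n"
    have c1: "finite C"
      using finite_or by (simp add: ptr(1) neq_clause_def Setcompr_eq_image)
    have c2: "lit_var ` C \<subseteq> bop_vars l n"
      using ptr by (auto simp: neq_clause_def or_clause_def bop_vars_def)
    have c3: "\<exists>x\<in>C. lit_true a x" if A: "{i, j} \<inter> S \<subseteq> A" and a: "a \<in> Sol A" for A a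
    proof -
      have fx: "fixed a" using a by (simp add: Sol_def)
      have neq: "\<exists>x\<in>neq_clause n j i. lit_true a x" if "\<not> pts a j i"
      proof -
        obtain b where b: "b \<in> {1..k}" "(Y j b \<in> a) \<noteq> bit i (b - 1)"
          using \<open>\<not> pts a j i\<close> unfolding pts_def by blast
        show ?thesis
        proof (cases "bit i (b - 1)")
          case True
          then have "Neg (Y j b) \<in> neq_clause n j i" using b by (auto simp: neq_clause_def floor_log_n simp del: One_nat_def)
          moreover have "lit_true a (Neg (Y j b))" using b True by simp
          ultimately show ?thesis by blast
        next
          case False
          then have "Pos (Y j b) \<in> neq_clause n j i" using b by (auto simp: neq_clause_def floor_log_n simp del: One_nat_def)
          moreover have "lit_true a (Pos (Y j b))" using b False by simp
          ultimately show ?thesis by blast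
        qed
      qed
      show ?thesis
      proof (cases "i \<in> S")
        case True
        show ?thesis
        proof (cases "j \<in> S")
          case True
          then have "pts a j i \<Longrightarrow> lt a i j" using a A \<open>i \<in> S\<close> ptr by (auto simp: Sol_def)
          then show ?thesis using neq or2[of a i j] ptr(1) by blast
        next
          case False
          then show ?thesis using or1[OF \<open>i \<in> S\<close> _ fx, of j] ptr by blast
        qed
      next
        case False
        have "\<not> pts a j i"
        proof (cases "j \<in> S")
          case True
          then show ?thesis using a A False ptr by (auto simp: Sol_def)
        next
          case jS: False
          obtain b where "b \<in> {1..k} - B j" "bit i (b - 1)" using cover[OF ptr(2) False] by blast
          moreover have "Y j b \<notin> a" using fx jS ptr calculation by (auto simp: fixed_def)
          ultimately show ?thesis by (auto simp: pts_def)
        qed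
        then show ?thesis using neq ptr(1) by blast
      qed
    qed
    show ?thesis
    proof (intro conjI c1 c2 index[of "{i, j}"])
      show "i' \<in> {i, j}" "j' \<in> {i, j}" if "X i' j' q \<in> lit_var ` C" for i' j' q
        using that by (auto simp: ptr(1) neq_clause_def or_clause_def)
      show "j' \<in> {i, j}" if "Y j' b \<in> lit_var ` C" for j' b
        using that by (auto simp: ptr(1) neq_clause_def or_clause_def)
    qed (use c3 in \<open>auto simp: card_insert_if\<close>)
  next
    fix i j p m m' assume trans: "C = {Neg (X i j m), Neg (X j p m')} \<union> or_clause l i p"
        "i < n" "j < n" "p < n" "m \<in> {1..l}" "m' \<in> {1..l}"
    have c1: "finite C" using finite_or by (simp add: trans)
    have c2: "lit_var ` C \<subseteq> bop_vars l n"
      using trans by (auto simp: or_clause_def bop_vars_def)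
    have c3: "\<exists>x\<in>C. lit_true a x" if A: "{i, j, p} \<inter> S \<subseteq> A" and a: "a \<in> Sol A" for A a
    proof (rule ccontr)
      assume F: "\<not> ?thesis"
      have fx: "fixed a" using a by (simp add: Sol_def)
      have x: "X i j m \<in> a" "X j p m' \<in> a" using F trans by auto
      then have ij: "i \<in> S" "j \<in> S" using inS fx trans(2,3) by blast+
      have no: "\<not> (\<exists>x\<in>or_clause l i p. lit_true a x)" using F trans by blast
      then have "p \<in> S" using or1[OF ij(1) _ fx, of p] trans by blast
      then have "lt a i j" "lt a j p" using lt x ij fx trans by auto
      then have "lt a i p" using a A ij \<open>p \<in> S\<close> unfolding Sol_def by blast
      then show False using or2 no by blast
    qed
    show ?thesis
    proof (intro conjI c1 c2 index[of "{i, j, p}"])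
      show "i' \<in> {i, j, p}" "j' \<in> {i, j, p}" if "X i' j' q \<in> lit_var ` C" for i' j' q
        using that by (auto simp: trans(1) or_clause_def)
      show "j' \<in> {i, j, p}" if "Y j' b \<in> lit_var ` C" for j' b
        using that by (auto simp: trans(1) or_clause_def)
    qed (use c3 in \<open>auto simp: card_insert_if\<close>)
  next
    fix i j m m' assume asym: "C = {Neg (X i j m), Neg (X j i m')}" "i < n" "j < n" "m \<in> {1..l}" "m' \<in> {1..l}"
    have c1: "finite C" by (simp add: asym)
    have c2: "lit_var ` C \<subseteq> bop_vars l n"
      using asym by (auto simp: bop_vars_def)
    have c3: "\<exists>x\<in>C. lit_true a x" if A: "{i, j} \<inter> S \<subseteq> A" and a: "a \<in> Sol A" for A a
    proof (rule ccontr)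
      assume F: "\<not> ?thesis"
      have fx: "fixed a" using a by (simp add: Sol_def)
      have x: "X i j m \<in> a" "X j i m' \<in> a" using F asym by auto
      then have ij: "i \<in> S" "j \<in> S" using inS fx asym(2,3) by blast+
      then have "lt a i j" "lt a j i" using lt x fx asym by auto
      \<comment> \<open>Asymmetry follows from transitivity and from the falsity of the variables
        \<open>X i i m\<close>.\<close>
      then have "lt a i i" using a A ij unfolding Sol_def by blast
      then show False using irrefl ij fx by blast
    qed
    show ?thesis
    proof (intro conjI c1 c2 index[of "{i, j}"])
      show "i' \<in> {i, j}" "j' \<in> {i, j}" if "X i' j' q \<in> lit_var ` C" for i' j' q
        using that by (auto simp: asym(1))
      show "j' \<in> {i, j}" if "Y j' b \<in> lit_var ` C" for j' b
        using that by (auto simp: asym(1))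
    qed (use c3 in \<open>auto simp: card_insert_if\<close>)
  qed
qed


lemma no_bop_refutation:
  fixes R :: "(bop_var, 'f::field) mpoly list" and \<sigma> :: "nat \<Rightarrow> nat \<Rightarrow> bop_var set"
  assumes two: "(2 :: 'f) \<noteq> 0" and l: "l \<ge> 2"
    and R: "pc_refutation (bop_vars l n) (clause_poly ` BOP_or l n) R"
    and \<sigma>: "\<And>i j. \<sigma> i j \<subseteq> Bl i j" "\<And>i j. i \<in> S \<Longrightarrow> j \<in> S \<Longrightarrow> \<sigma> i j \<noteq> {}"
    and \<X>: "\<And>p M. p \<in> set R \<Longrightarrow> mcoeff p M \<noteq> 0 \<Longrightarrow> M \<in> \<X>" "\<And>M. M \<in> \<X> \<Longrightarrow> M \<subseteq> bop_vars l n"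
    and e: "\<And>m. m \<in> \<X> \<Longrightarrow> card (tails \<sigma> m) \<le> e"
    and h: "\<And>m m'. m \<in> \<X> \<Longrightarrow> m' \<in> \<X> \<Longrightarrow> (m \<triangle> m') \<inter> T = {} \<Longrightarrow> card (heads (m \<triangle> m')) \<le> h"
    and room: "3 * e + 2 * h + 4 < card S"
  shows False
proof -
  interpret pc_worlds "bop_vars l n" T S Bl Yv Sol \<sigma> \<X> e h
    by unfold_locales (use \<sigma> \<X> e h room in auto)
  show False
    by (rule no_refutation[OF two R \<X>(1)]) (use clause_true[OF l] in \<open>simp_all\<close>)
qed

end

section \<open>Counting\<close>

text \<open>Here \<open>Q \<union> U\<close> is the kept set and \<open>G\<close> gives the arrows
  of a quotient. The condition \<open>followers r G Q N U \<subseteq> Q \<union> U\<close> says that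
  no arrow ascending in \<open>r\<close> leaves the kept set, that is, enters a split block. Two
  opposite orders \<open>r\<close> cover all arrows between distinct elements.\<close>

definition followers :: "('a \<Rightarrow> int) \<Rightarrow> ('a \<Rightarrow> 'a \<Rightarrow> bool) \<Rightarrow> 'a set \<Rightarrow> 'a set \<Rightarrow> 'a set \<Rightarrow> 'a set" where
  "followers r G Q N U = {j \<in> N. \<exists>i\<in>N. r i < r j \<and> i \<in> Q \<union> U \<and> G i j}"

text \<open>
  Deciding membership in \<open>U\<close> in the order given by \<open>r\<close>, each follower outside \<open>Q\<close> is forced
  into \<open>U\<close>, at the cost of a factor \<open>1/2\<close>.
\<close>

lemma sum_closed_sets:
  fixes r :: "'a \<Rightarrow> int"
  assumes "finite N" "inj r"
  shows "(\<Sum>U\<in>Pow N. if followers r G Q N U \<subseteq> Q \<union> U then 2 ^ card (followers r G Q N U - Q) else 0) \<le> (2::nat) ^ card N"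
  using assms(1)
proof (induction N rule: finite_ranking_induct[where f = r])
  case empty
  then show ?case by (simp add: followers_def)
next
  case (insert x N)
  show ?case
  proof (cases "x \<in> N")
    case True
    then have "insert x N = N" by auto
    then show ?thesis using insert.IH by metis
  next
    case False
    have lt: "r y < r x" if "y \<in> N" for y
      using insert.hyps(2)[OF that] inj_eq[OF assms(2), of x y] False that by (metis order_le_less)
    define g where "g N U = (if followers r G Q N U \<subseteq> Q \<union> U then 2 ^ card (followers r G Q N U - Q) else (0::nat))" for N U
    have "g (insert x N) U + g (insert x N) (insert x U) \<le> 2 * g N U" if U: "U \<in> Pow N" for U
    proof -
      have xU: "x \<notin> U" "U \<subseteq> N" using U False by auto
      \<comment> \<open>As \<open>x\<close> is last in the order, adding it to \<open>U\<close>
        creates no follower, and whether it is a follower itself depends on \<open>U\<close> only.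
        If it is one and lies outside \<open>Q\<close>, only \<open>insert x U\<close> can be
        closed, which pays for the doubled weight.\<close>
      define forced where "forced \<longleftrightarrow> (\<exists>i\<in>N. i \<in> Q \<union> U \<and> G i x)"
      have F1: "followers r G Q (insert x N) U' = (if forced then insert x (followers r G Q N U) else followers r G Q N U)" if "U' = U \<or> U' = insert x U" for U'
        using that lt False unfolding followers_def forced_def by (auto 4 3 dest: lt)
      have FN: "followers r G Q N U \<subseteq> N" by (auto simp: followers_def)
      then have xF: "x \<notin> followers r G Q N U" "finite (followers r G Q N U)" using False insert.hyps finite_subset by auto
      have c: "followers r G Q N U \<subseteq> Q \<union> insert x U \<longleftrightarrow> followers r G Q N U \<subseteq> Q \<union> U" using xF by auto
      show ?thesis
      proof (cases "forced \<and> x \<notin> Q")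
        case True
        then have "insert x (followers r G Q N U) - Q = insert x (followers r G Q N U - Q)" by auto
        then show ?thesis using True F1 xF xU c by (auto simp: g_def)
      next
        case False
        then have "followers r G Q (insert x N) U' - Q = followers r G Q N U - Q" if "U' = U \<or> U' = insert x U" for U'
          using F1[OF that] by auto
        then show ?thesis using False F1 c by (auto simp: g_def)
      qed
    qed
    then have "(\<Sum>U\<in>Pow N. g (insert x N) U + g (insert x N) (insert x U)) \<le> (\<Sum>U\<in>Pow N. 2 * g N U)"
      by (rule sum_mono)
    also have "\<dots> \<le> 2 * 2 ^ card N"
      using insert.IH by (simp add: g_def sum_distrib_left[symmetric])
    finally show ?thesis
      using False insert.hyps by (simp add: sum_Pow_insert sum.distrib g_def)
  qed
qed

text \<open>Markov's inequality: each counted \<open>U\<close> has weight at least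
  \<open>2 ^ t\<close> in \<open>sum_closed_sets\<close>.\<close>

lemma card_closed_sets:
  fixes r :: "'a \<Rightarrow> int"
  assumes "finite N" "inj r"
  shows "card {U \<in> Pow N. followers r G Q N U \<subseteq> Q \<union> U \<and> t \<le> card (followers r G Q N U - Q)} * 2 ^ t \<le> 2 ^ card N"
proof -
  let ?A = "{U \<in> Pow N. followers r G Q N U \<subseteq> Q \<union> U \<and> t \<le> card (followers r G Q N U - Q)}"
  have "card ?A * 2 ^ t = (\<Sum>U\<in>?A. 2 ^ t)" by simp
  also have "\<dots> \<le> (\<Sum>U\<in>?A. if followers r G Q N U \<subseteq> Q \<union> U then 2 ^ card (followers r G Q N U - Q) else 0)"
    by (rule sum_mono) auto
  also have "\<dots> \<le> (\<Sum>U\<in>Pow N. if followers r G Q N U \<subseteq> Q \<union> U then 2 ^ card (followers r G Q N U - Q) else 0)"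
    by (rule sum_mono2) (use assms(1) in auto)
  also have "\<dots> \<le> 2 ^ card N"
    by (rule sum_closed_sets[OF assms])
  finally show ?thesis .
qed

text \<open>For each \<open>j \<in> J\<close> exactly one of the four combinations of membership in
  the two sets is excluded; elements outside \<open>J\<close> are unrestricted.\<close>

lemma card_unsplit_pairs:
  assumes "finite N" "J \<subseteq> N"
  shows "card {p \<in> Pow N \<times> Pow N. \<forall>j\<in>J. j \<in> fst p \<or> (j \<in> snd p) \<noteq> b j} = 3 ^ card J * 4 ^ card (N - J)"
proof -
  define c where "c J U W = (if \<forall>j\<in>J. j \<in> U \<or> (j \<in> W) \<noteq> b j then 1 else (0::nat))" for J U W
  have "(\<Sum>U\<in>Pow N. \<Sum>W\<in>Pow N. c (J \<inter> N) U W) = 3 ^ card (J \<inter> N) * 4 ^ card (N - J)"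
    using assms(1)
  proof (induction N rule: finite_induct)
    case empty
    then show ?case by (simp add: c_def)
  next
    case (insert x N)
    let ?J = "J \<inter> insert x N"
    have "(\<Sum>U\<in>Pow (insert x N). \<Sum>W\<in>Pow (insert x N). c ?J U W) =
      (\<Sum>U\<in>Pow N. \<Sum>W\<in>Pow N. c ?J U W + c ?J U (insert x W) + c ?J (insert x U) W + c ?J (insert x U) (insert x W))"
      using insert.hyps by (simp add: sum_Pow_insert sum.distrib add_ac)
    also have "\<dots> = (\<Sum>U\<in>Pow N. \<Sum>W\<in>Pow N. (if x \<in> J then 3 else 4) * c (J \<inter> N) U W)"
    proof (intro sum.cong refl)
      fix U W assume UW: "U \<in> Pow N" "W \<in> Pow N"
      have J: "?J = (if x \<in> J then insert x (J \<inter> N) else J \<inter> N)" by auto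
      have *: "(\<forall>j\<in>J \<inter> N. j \<in> U' \<or> (j \<in> W') \<noteq> b j) \<longleftrightarrow> (\<forall>j\<in>J \<inter> N. j \<in> U \<or> (j \<in> W) \<noteq> b j)"
        if "U' = U \<or> U' = insert x U" "W' = W \<or> W' = insert x W" for U' W'
        using that insert.hyps(2) by (intro ball_cong) auto
      have "x \<notin> U" "x \<notin> W" using UW insert.hyps by auto
      then show "c ?J U W + c ?J U (insert x W) + c ?J (insert x U) W + c ?J (insert x U) (insert x W) =
          (if x \<in> J then 3 else 4) * c (J \<inter> N) U W"
        unfolding c_def J
        using *[of U W] *[of U "insert x W"] *[of "insert x U" W] *[of "insert x U" "insert x W"]
        by (cases "x \<in> J") (simp_all split del: if_split, simp_all)
    qed
    also have "\<dots> = (if x \<in> J then 3 else 4) * (3 ^ card (J \<inter> N) * 4 ^ card (N - J))"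
      unfolding sum_distrib_left[symmetric] insert.IH ..
    also have "\<dots> = 3 ^ card ?J * 4 ^ card (insert x N - J)"
      using insert.hyps by (auto simp: insert_Diff_if)
    finally show ?case .
  qed
  moreover have "(\<Sum>U\<in>Pow N. \<Sum>W\<in>Pow N. c J U W) = card {p \<in> Pow N \<times> Pow N. \<forall>j\<in>J. j \<in> fst p \<or> (j \<in> snd p) \<noteq> b j}"
  proof -
    have "(\<Sum>U\<in>Pow N. \<Sum>W\<in>Pow N. c J U W) = (\<Sum>p\<in>Pow N \<times> Pow N. if \<forall>j\<in>J. j \<in> fst p \<or> (j \<in> snd p) \<noteq> b j then 1 else 0)"
      unfolding c_def by (simp add: sum.cartesian_product split_def)
    also have "\<dots> = card {p \<in> Pow N \<times> Pow N. \<forall>j\<in>J. j \<in> fst p \<or> (j \<in> snd p) \<noteq> b j}"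
      using assms(1) by (subst sum.inter_filter[symmetric]) simp_all
    finally show ?thesis .
  qed
  moreover have "J \<inter> N = J" using assms by auto
  ultimately show ?thesis by simp
qed

text \<open>Complementation maps the sets with less than half of the elements injectively to sets
  with more than half.\<close>

lemma card_small_subsets:
  assumes "finite N"
  shows "2 * card {U \<in> Pow N. 2 * card U < card N} \<le> 2 ^ card N"
proof -
  let ?A = "{U \<in> Pow N. 2 * card U < card N}"
  have fin: "finite ?A" using assms by simp
  have inj: "inj_on (\<lambda>U. N - U) ?A" by (rule inj_onI) auto
  have disj: "?A \<inter> (\<lambda>U. N - U) ` ?A = {}"
  proof -
    have "\<not> 2 * card (N - U) < card N" if "U \<in> ?A" for U
    proof -
      have "card (N - U) = card N - card U" "2 * card U < card N"
        using that assms by (auto simp: card_Diff_subset finite_subset)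
      then show ?thesis by linarith
    qed
    then show ?thesis by auto
  qed
  have "2 * card ?A = card (?A \<union> (\<lambda>U. N - U) ` ?A)"
    using card_Un_disjoint[OF fin finite_imageI[OF fin] disj] card_image[OF inj] by linarith
  also have "\<dots> \<le> card (Pow N)"
    by (rule card_mono) (use assms in auto)
  finally show ?thesis using assms by (simp add: card_Pow)
qed

text \<open>Exponential moment bound: for a uniformly random \<open>\<sigma>\<close> the expectation
  of 2 to the number of matches is a product of factors of at most \<open>1 + 1 / card C\<close>,
  hence at most \<open>exp 1 \<le> 3\<close> since \<open>card E \<le> card C\<close>.\<close>

lemma card_matching_functions:
  fixes C :: "'b set" and E :: "'a set"
  assumes "finite E" "finite C" "card E \<le> card C" "C \<noteq> {}"
  shows "real (card {\<sigma> \<in> PiE E (\<lambda>_. C). e \<le> card {p \<in> E. f p = \<sigma> p}}) * 2 ^ e \<le> 3 * real (card (PiE E (\<lambda>_. C)))"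
proof -
  let ?P = "PiE E (\<lambda>_. C)" and ?K = "card C"
  let ?A = "{\<sigma> \<in> ?P. e \<le> card {p \<in> E. f p = \<sigma> p}}"
  have finP: "finite ?P" using assms by (intro finite_PiE) auto
  have K: "?K > 0" using assms by auto
  have "card ?A * 2 ^ e = (\<Sum>\<sigma>\<in>?A. 2 ^ e)" by simp
  also have "\<dots> \<le> (\<Sum>\<sigma>\<in>?A. 2 ^ card {p \<in> E. f p = \<sigma> p})"
    by (rule sum_mono) auto
  also have "\<dots> \<le> (\<Sum>\<sigma>\<in>?P. 2 ^ card {p \<in> E. f p = \<sigma> p})"
    by (rule sum_mono2) (use finP in auto)
  also have "\<dots> = (\<Sum>\<sigma>\<in>?P. \<Prod>p\<in>E. if f p = \<sigma> p then 2 else 1)"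
  proof (rule sum.cong[OF refl])
    fix \<sigma>
    show "2 ^ card {p \<in> E. f p = \<sigma> p} = (\<Prod>p\<in>E. if f p = \<sigma> p then 2 else (1::nat))"
      using assms(1) by (simp add: prod.inter_filter[symmetric])
  qed
  also have "\<dots> = (\<Prod>p\<in>E. \<Sum>c\<in>C. if f p = c then 2 else 1)"
    by (rule prod_sum_PiE[symmetric]) (use assms in auto)
  also have "\<dots> \<le> (\<Prod>p\<in>E. ?K + 1)"
  proof (rule prod_mono)
    fix p assume "p \<in> E"
    have "(\<Sum>c\<in>C. if f p = c then 2 else 1) = (\<Sum>c\<in>C. 1 + (if f p = c then 1 else (0::nat)))"
      by (rule sum.cong) auto
    also have "\<dots> \<le> ?K + 1"
      unfolding sum.distrib using assms(2) by (simp add: sum.delta)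
    finally show "0 \<le> (\<Sum>c\<in>C. if f p = c then 2 else (1::nat)) \<and> (\<Sum>c\<in>C. if f p = c then 2 else 1) \<le> ?K + 1"
      by simp
  qed
  also have "\<dots> = (?K + 1) ^ card E" by simp
  finally have "real (card ?A * 2 ^ e) \<le> real ((?K + 1) ^ card E)"
    by (simp only: of_nat_le_iff)
  also have "\<dots> = (real ?K) ^ card E * (1 + 1 / real ?K) ^ card E"
    using K by (simp add: power_mult_distrib[symmetric] distrib_left add.commute)
  also have "\<dots> \<le> (real ?K) ^ card E * 3"
  proof (rule mult_left_mono)
    have "(1 + 1 / real ?K) ^ card E \<le> (1 + 1 / real ?K) ^ ?K"
      by (rule power_increasing) (use assms in auto)
    also have "\<dots> \<le> exp (1 / real ?K) ^ ?K"
      by (rule power_mono) (use exp_ge_add_one_self in auto)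
    also have "\<dots> = exp 1" using K by (simp add: exp_of_nat_mult[symmetric])
    also have "\<dots> \<le> 3" by (rule exp_le)
    finally show "(1 + 1 / real ?K) ^ card E \<le> 3" .
  qed simp
  also have "\<dots> = 3 * real (card ?P)"
    using assms by (simp add: card_PiE)
  finally show ?thesis by simp
qed

text \<open>The first alternative leaves only numbers below 64, the second only multiples of
  64.\<close>

lemma card_aligned:
  fixes n :: nat
  assumes "n = 2 ^ k" "6 \<le> k"
  shows "card {i. i < n \<and> ((\<forall>b\<in>{7..k}. \<not> bit i (b - 1)) \<or> (\<forall>b\<in>{1..6}. \<not> bit i (b - 1)))} \<le> 64 + 2 ^ (k - 6)"
    (is "card ?Q \<le> _")
proof -
  have high: "\<not> bit i b" if "i < n" "k \<le> b" for i b
  proof -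
    have "i < 2 ^ b"
      using that assms(1) by (meson less_le_trans one_le_numeral power_increasing)
    then show ?thesis by (simp add: bit_nat_def)
  qed
  have 1: "i < 64" if "i < n" "\<forall>b\<in>{7..k}. \<not> bit i (b - 1)" for i
  proof -
    have "take_bit 6 i = i"
    proof (rule bit_eqI)
      fix b
      have "\<not> bit i b" if "6 \<le> b"
        using \<open>\<forall>b\<in>{7..k}. \<not> bit i (b - 1)\<close>[rule_format, of "Suc b"] high[OF \<open>i < n\<close>, of b] that
        by (cases "b < k") auto
      then show "bit (take_bit 6 i) b = bit i b" by (cases "b < 6") (auto simp: bit_take_bit_iff)
    qed
    then show ?thesis using take_bit_nat_less_exp[of 6 i] by simp
  qed
  have 2: "i \<in> (\<lambda>q. q * 64) ` {..<2 ^ (k - 6)}" if "i < n" "\<forall>b\<in>{1..6}. \<not> bit i (b - 1)" for i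
  proof -
    have "take_bit 6 i = 0"
    proof (rule bit_eqI)
      fix b
      show "bit (take_bit 6 i) b = bit (0::nat) b"
        using that(2)[rule_format, of "Suc b"] by (auto simp: bit_take_bit_iff)
    qed
    then have "i mod 64 = 0" by (simp add: take_bit_eq_mod)
    then have i: "i = (i div 64) * 64" by presburger
    have "(2::nat) ^ k = 2 ^ (k - 6) * 64"
      using assms(2) power_add[of "2::nat" "k - 6" 6] by simp
    then have "i div 64 < 2 ^ (k - 6)" using that(1) assms(1) by (simp add: less_mult_imp_div_less)
    then show ?thesis using i by blast
  qed
  have "?Q \<subseteq> {..<64} \<union> (\<lambda>q. q * 64) ` {..<2 ^ (k - 6)}"
    using 1 2 by auto
  then have "card ?Q \<le> card ({..<64::nat} \<union> (\<lambda>q. q * 64) ` {..<2 ^ (k - 6)})"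
    by (rule card_mono[rotated]) simp
  also have "\<dots> \<le> card {..<64::nat} + card ((\<lambda>q. q * 64) ` {..<(2::nat) ^ (k - 6)})"
    by (rule card_Un_le)
  also have "\<dots> \<le> 64 + 2 ^ (k - 6)"
    using card_image_le[of "{..<(2::nat) ^ (k - 6)}" "\<lambda>q. q * 64"] by simp
  finally show ?thesis .
qed

section \<open>The size lower bound\<close>

definition pattern :: "nat \<Rightarrow> bop_var set \<Rightarrow> nat \<times> nat \<Rightarrow> nat set" where
  "pattern l M p = {q \<in> {2..l}. X (fst p) (snd p) q \<in> M}"

text \<open>Union bound over \<open>\<X>\<close> for a random choice of nonempty characters. There
  are \<open>2 ^ (l - 1) - 1\<close> nonempty subsets of \<open>{2..l}\<close>, at least as many as
  the \<open>n ^ 2\<close> blocks, as \<open>card_matching_functions\<close> requires.\<close>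

lemma exists_characters:
  assumes X: "finite \<X>" "real (card \<X>) * 3 < 2 ^ e" and l: "n ^ 2 \<le> 2 ^ (l - 1) - 1" "l \<ge> 2"
  shows "\<exists>\<sigma>. (\<forall>p\<in>{..<n} \<times> {..<n}. \<sigma> p \<subseteq> {2..l} \<and> \<sigma> p \<noteq> {}) \<and>
     (\<forall>M\<in>\<X>. card {p \<in> {..<n} \<times> {..<n}. pattern l M p = \<sigma> p} < e)"
proof -
  let ?E = "{..<n} \<times> {..<n}" and ?C = "Pow {2..l} - {{}}"
  let ?P = "PiE ?E (\<lambda>_. ?C)"
  define bad where "bad M = {\<sigma> \<in> ?P. e \<le> card {p \<in> ?E. pattern l M p = \<sigma> p}}" for M
  have cC: "card ?C = 2 ^ (l - 1) - 1" by (simp add: card_Diff_singleton card_Pow)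
  have "2 \<in> {2..l}" using l by simp
  then have C: "?C \<noteq> {}" by blast
  have finP: "finite ?P" by (intro finite_PiE) auto
  have P0: "real (card ?P) > 0"
    using finP C by (simp add: card_gt_0_iff PiE_eq_empty_iff)
  have b: "real (card (bad M)) * 2 ^ e \<le> 3 * real (card ?P)" for M
    unfolding bad_def
    by (rule card_matching_functions) (use C cC l in \<open>auto simp: power2_eq_square\<close>)
  have "real (card (\<Union>M\<in>\<X>. bad M)) * 2 ^ e \<le> (\<Sum>M\<in>\<X>. real (card (bad M))) * 2 ^ e"
    using card_UN_le[OF X(1), of bad] by (simp flip: of_nat_sum)
  also have "\<dots> \<le> (\<Sum>M\<in>\<X>. 3 * real (card ?P))"
    unfolding sum_distrib_right by (rule sum_mono) (rule b)
  also have "\<dots> = real (card \<X>) * 3 * real (card ?P)" by simp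
  also have "\<dots> < 2 ^ e * real (card ?P)"
    using X(2) P0 by (intro mult_strict_right_mono)
  finally have "card (\<Union>M\<in>\<X>. bad M) < card ?P"
    by (simp add: mult.commute)
  then have "\<not> ?P \<subseteq> (\<Union>M\<in>\<X>. bad M)"
    using card_mono[of "\<Union>M\<in>\<X>. bad M" ?P] X(1) finP by (auto simp: bad_def)
  then obtain \<sigma> where \<sigma>: "\<sigma> \<in> ?P" "\<And>M. M \<in> \<X> \<Longrightarrow> \<sigma> \<notin> bad M" by blast
  have "\<sigma> p \<subseteq> {2..l} \<and> \<sigma> p \<noteq> {}" if "p \<in> ?E" for p
    using PiE_mem[OF \<sigma>(1) that] by simp
  moreover have "card {p \<in> ?E. pattern l M p = \<sigma> p} < e" if "M \<in> \<X>" for M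
    using \<sigma>(2)[OF that] \<sigma>(1) unfolding bad_def by (simp add: not_le)
  ultimately show ?thesis by blast
qed

definition arrow :: "nat \<Rightarrow> bop_var set \<Rightarrow> nat \<Rightarrow> nat \<Rightarrow> bool" where
  "arrow l M i j \<longleftrightarrow> pattern l M (i, j) \<noteq> {}"

definition pointing :: "nat \<Rightarrow> nat \<Rightarrow> bop_var set \<Rightarrow> nat set" where
  "pointing n k M = {j. j < n \<and> (\<exists>b\<in>{1..k}. Y j b \<in> M)}"

text \<open>Union bound for random \<open>U\<close> and \<open>W\<close>: \<open>U\<close> supplies
  kept elements, and \<open>W\<close> decides which group of bits of a pointer is split. For each
  quotient the two orders contribute \<open>2 / 2 ^ t\<close> and the pointers
  \<open>(3 / 4) ^ t\<close>; the remaining probability 1/2 covers the sets \<open>U\<close> with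
  fewer than half of the elements.\<close>

lemma exists_split:
  assumes P: "finite P" "real (card P) * (2 / 2 ^ t + (3 / 4) ^ t) < 1 / 2" and Q: "Q \<subseteq> {..<n}"
  shows "\<exists>U W. U \<subseteq> {..<n} \<and> W \<subseteq> {..<n} \<and> n \<le> 2 * card U \<and> (\<forall>M\<in>P.
     (\<forall>r\<in>{int, \<lambda>j. - int j}. followers r (arrow l M) Q {..<n} U \<subseteq> Q \<union> U \<longrightarrow>
        card (followers r (arrow l M) Q {..<n} U - Q) < t) \<and>
     (card (pointing n k M - Q) < t \<or>
        (\<exists>j\<in>pointing n k M - Q. j \<notin> U \<and> (j \<in> W) = (\<exists>b\<in>{1..6}. Y j b \<in> M))))"
proof -
  let ?N = "{..<n}"
  let ?\<Omega> = "Pow ?N \<times> Pow ?N"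
  define A where "A r M = {U \<in> Pow ?N. followers r (arrow l M) Q ?N U \<subseteq> Q \<union> U \<and>
      t \<le> card (followers r (arrow l M) Q ?N U - Q)}" for r M
  define B where "B M = (if card (pointing n k M - Q) < t then {} else
      {p \<in> ?\<Omega>. \<forall>j\<in>pointing n k M - Q. j \<in> fst p \<or> (j \<in> snd p) \<noteq> (\<exists>b\<in>{1..6}. Y j b \<in> M)})" for M
  define Z where "Z = {U \<in> Pow ?N. 2 * card U < card ?N}"
  define bad where "bad = (\<Union>M\<in>P. A int M \<times> Pow ?N \<union> A (\<lambda>j. - int j) M \<times> Pow ?N \<union> B M) \<union> Z \<times> Pow ?N"
  have cN: "card (Pow ?N) = 2 ^ n" by (simp add: card_Pow)
  have A: "real (card (A r M)) \<le> 2 ^ n / 2 ^ t" if "inj r" for r M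
  proof -
    have "card (A r M) * 2 ^ t \<le> 2 ^ n"
      using card_closed_sets[OF _ that, of ?N "arrow l M" Q t] by (simp add: A_def)
    then have "real (card (A r M) * 2 ^ t) \<le> real (2 ^ n)" by (simp only: of_nat_le_iff)
    then show ?thesis by (simp add: field_simps)
  qed
  have B: "real (card (B M)) \<le> 4 ^ n * (3 / 4) ^ t" for M
  proof (cases "card (pointing n k M - Q) < t")
    case False
    let ?J = "pointing n k M - Q"
    have J: "?J \<subseteq> ?N" by (auto simp: pointing_def)
    then have finJ: "finite ?J" and le: "card ?J \<le> n"
      using finite_subset card_mono[OF _ J] by auto
    have cd: "card (?N - ?J) = n - card ?J" using J finJ by (simp add: card_Diff_subset)
    have "card (B M) = 3 ^ card ?J * 4 ^ card (?N - ?J)"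
      unfolding B_def if_not_P[OF False] by (rule card_unsplit_pairs[OF _ J]) simp
    then have "real (card (B M)) = 3 ^ card ?J * 4 ^ (n - card ?J)"
      by (simp add: cd)
    also have "\<dots> = 4 ^ n * (3 / 4) ^ card ?J"
      using le by (simp add: power_diff power_divide field_simps)
    also have "\<dots> \<le> 4 ^ n * (3 / 4) ^ t"
      using False by (intro mult_left_mono power_decreasing) auto
    finally show ?thesis .
  qed (simp add: B_def)
  have Z: "real (card Z) \<le> 2 ^ n / 2"
  proof -
    have "2 * card Z \<le> 2 ^ n" using card_small_subsets[of ?N] by (simp add: Z_def)
    then have "real (2 * card Z) \<le> real (2 ^ n)" by (simp only: of_nat_le_iff)
    then show ?thesis by simp
  qed
  have two: "(2::real) ^ n * 2 ^ n = 4 ^ n" by (simp flip: power_mult_distrib)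
  have "real (card bad) \<le> real (card P) * ((2 / 2 ^ t + (3 / 4) ^ t) * 4 ^ n) + 4 ^ n / 2"
  proof -
    let ?f = "\<lambda>M. A int M \<times> Pow ?N \<union> A (\<lambda>j. - int j) M \<times> Pow ?N \<union> B M"
    have "real (card (?f M)) \<le> (2 / 2 ^ t + (3 / 4) ^ t) * 4 ^ n" for M
    proof -
      have "card (?f M) \<le> card (A int M \<times> Pow ?N) + card (A (\<lambda>j. - int j) M \<times> Pow ?N) + card (B M)"
        by (meson card_Un_le order_trans add_mono le_refl)
      then have "real (card (?f M)) \<le> real (card (A int M \<times> Pow ?N) + card (A (\<lambda>j. - int j) M \<times> Pow ?N) + card (B M))"
        by (simp only: of_nat_le_iff)
      also have "\<dots> = real (card (A int M)) * 2 ^ n + real (card (A (\<lambda>j. - int j) M)) * 2 ^ n + real (card (B M))"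
        by (simp only: of_nat_add of_nat_mult card_cartesian_product cN of_nat_power of_nat_numeral)
      also have "\<dots> \<le> 2 ^ n / 2 ^ t * 2 ^ n + 2 ^ n / 2 ^ t * 2 ^ n + 4 ^ n * (3 / 4) ^ t"
        by (intro add_mono mult_right_mono A B) (auto simp: inj_def)
      also have "\<dots> = (2 / 2 ^ t + (3 / 4) ^ t) * 4 ^ n"
        using two by (simp add: field_simps)
      finally show ?thesis .
    qed
    then have "(\<Sum>M\<in>P. real (card (?f M))) \<le> (\<Sum>M\<in>P. (2 / 2 ^ t + (3 / 4) ^ t) * 4 ^ n)"
      by (intro sum_mono)
    moreover have "real (card (\<Union>M\<in>P. ?f M)) \<le> (\<Sum>M\<in>P. real (card (?f M)))"
      using card_UN_le[OF P(1), of ?f] by (simp flip: of_nat_sum)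
    moreover have "real (card (Z \<times> Pow ?N)) \<le> 4 ^ n / 2"
      unfolding card_cartesian_product cN using mult_right_mono[OF Z, of "2 ^ n"] two by (simp add: field_simps)
    moreover have "real (card bad) \<le> real (card (\<Union>M\<in>P. ?f M)) + real (card (Z \<times> Pow ?N))"
      unfolding bad_def of_nat_add[symmetric] of_nat_le_iff by (rule card_Un_le)
    ultimately show ?thesis by simp
  qed
  also have "\<dots> < 1 / 2 * 4 ^ n + 4 ^ n / 2"
    using mult_strict_right_mono[OF P(2), of "4 ^ n"] unfolding mult.assoc[symmetric]
    by (intro add_strict_right_mono) simp
  also have "\<dots> = real (card ?\<Omega>)" using two by (simp add: card_cartesian_product cN)
  finally have lt: "card bad < card ?\<Omega>" by (simp only: of_nat_less_iff)
  have "finite bad" using P(1) by (auto simp: bad_def A_def B_def Z_def)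
  then have "\<not> ?\<Omega> \<subseteq> bad" using card_mono[of bad ?\<Omega>] lt by auto
  then obtain U W where UW: "U \<in> Pow ?N" "W \<in> Pow ?N" "(U, W) \<notin> bad" by auto
  have "U \<notin> Z" using UW by (auto simp: bad_def)
  then have "n \<le> 2 * card U" using UW by (simp add: Z_def not_less)
  moreover have "card (followers r (arrow l M) Q ?N U - Q) < t"
    if "M \<in> P" "r \<in> {int, \<lambda>j. - int j}" "followers r (arrow l M) Q ?N U \<subseteq> Q \<union> U" for M r
  proof -
    have "U \<notin> A r M" using UW that(1,2) unfolding bad_def by blast
    then show ?thesis using UW(1) that(3) unfolding A_def by (simp add: not_le)
  qed
  moreover have "card (pointing n k M - Q) < t \<or>
        (\<exists>j\<in>pointing n k M - Q. j \<notin> U \<and> (j \<in> W) = (\<exists>b\<in>{1..6}. Y j b \<in> M))" if "M \<in> P" for M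
  proof (rule ccontr)
    assume F: "\<not> ?thesis"
    then have "(U, W) \<in> B M"
      using UW(1,2) unfolding B_def by auto
    then show False using UW(3) that unfolding bad_def by blast
  qed
  ultimately show ?thesis using UW(1,2) by blast
qed

text \<open>The number of quotients of two monomials is at most the square of the size. If this were
  below \<open>2 ^ (n div 256)\<close>, the random choices would yield a setting for
  \<open>no_bop_refutation\<close>.\<close>

lemma size_bound:
  fixes R :: "(bop_var, 'f::field) mpoly list"
  assumes two: "(2 :: 'f) \<noteq> 0" and n: "n = 2 ^ k" "12 \<le> k" and l: "10 * k < l"
    and R: "pc_refutation (bop_vars l n) (clause_poly ` BOP_or l n) R"
  shows "2 ^ (n div 256) \<le> (pc_size R) ^ 2"
proof (rule ccontr)
  assume small: "\<not> ?thesis"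
  \<comment> \<open>All parameters are measured in \<open>u\<close>: at most \<open>2 ^ u\<close>
    quotients, \<open>e = 5 * u\<close>, \<open>card Q \<le> 8 * u\<close>,
    \<open>h \<le> 23 * u\<close>, and at least \<open>128 * u\<close> kept elements, which exceeds
    \<open>3 * e + 2 * h + 4\<close>.\<close>
  define u where "u = n div 256"
  have u: "n = 256 * u" "u = 2 ^ (k - 8)"
    using n power_add[of "2::nat" "k - 8" 8] by (auto simp: u_def)
  have u16: "16 \<le> u"
    using power_increasing[of 4 "k - 8" "2::nat"] n(2) u by simp
  have s: "(pc_size R) ^ 2 < 2 ^ u" using small by (simp add: u_def)
  define \<X> where "\<X> = (\<Union>p\<in>set R. {M. mcoeff p M \<noteq> 0})"
  have finX: "finite \<X>" unfolding \<X>_def using finite_support_mcoeff by blast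
  have cX: "card \<X> \<le> pc_size R"
  proof -
    have "card (\<Union>p\<in>set ps. {M. mcoeff p M \<noteq> 0}) \<le> (\<Sum>p\<leftarrow>ps. num_monomials p)" for ps :: "(bop_var, 'f) mpoly list"
    proof (induction ps)
      case (Cons p ps)
      have "card ({M. mcoeff p M \<noteq> 0} \<union> (\<Union>p\<in>set ps. {M. mcoeff p M \<noteq> 0})) \<le> num_monomials p + (\<Sum>p\<leftarrow>ps. num_monomials p)"
        by (rule order_trans[OF card_Un_le add_mono[OF card_support_mcoeff Cons.IH]])
      then show ?case by simp
    qed simp
    then show ?thesis by (simp add: \<X>_def pc_size_def)
  qed
  have X2: "card \<X> ^ 2 < 2 ^ u"
    by (rule le_less_trans[OF power_mono[OF cX] s]) simp
  have X1: "card \<X> < 2 ^ u"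
    using le_less_trans[OF le_square[of "card \<X>"]] X2 by (simp add: power2_eq_square)
  have fl: "floor_log n = k" by (simp add: n)
  have lk: "l \<ge> 2" "2 * k \<le> l - 2" "k > 0" using l n by auto
  have clause: "finite C \<and> lit_var ` C \<subseteq> bop_vars l n" if "C \<in> BOP_or l n" for C
  proof -
    \<comment> \<open>With all elements kept nothing is split; this instance serves to read off the
      finiteness and the variables of the clauses.\<close>
    interpret bop_split n k l "{..<n}" "\<lambda>_. {}"
      by unfold_locales (use n in auto)
    show ?thesis using clause_true[OF lk(1) that] by blast
  qed
  have XV: "M \<subseteq> bop_vars l n" if "M \<in> \<X>" for M
  proof -
    from that obtain r where "r < length R" "mcoeff (R ! r) M \<noteq> 0"
      unfolding \<X>_def by (auto simp: in_set_conv_nth)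
    then show ?thesis using refutation_support[OF R] clause by blast
  qed
  have "real (card \<X>) * 3 < 2 ^ (5 * u)"
  proof -
    have "real (card \<X>) < 2 ^ u" using X1 by (metis of_nat_less_iff of_nat_numeral of_nat_power)
    moreover have "(2::real) ^ u * 4 \<le> 2 ^ (5 * u)"
      using power_increasing[of "u + 2" "5 * u" "2::real"] u16 by (simp add: power_add)
    ultimately show ?thesis by linarith
  qed
  moreover have "n ^ 2 \<le> 2 ^ (l - 1) - 1"
  proof -
    have "n ^ 2 = 2 ^ (2 * k)" by (simp add: n power_mult mult.commute)
    also have "\<dots> \<le> 2 ^ (l - 2)" using lk by (intro power_increasing) auto
    also have "\<dots> \<le> 2 ^ (l - 1) - 1"
    proof -
      have "l - 1 = Suc (l - 2)" using lk by linarith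
      then show ?thesis using one_le_power[of "2::nat" "l - 2"] by simp
    qed
    finally show ?thesis .
  qed
  ultimately have "\<exists>\<sigma>. (\<forall>p\<in>{..<n} \<times> {..<n}. \<sigma> p \<subseteq> {2..l} \<and> \<sigma> p \<noteq> {}) \<and>
     (\<forall>M\<in>\<X>. card {p \<in> {..<n} \<times> {..<n}. pattern l M p = \<sigma> p} < 5 * u)"
    by (intro exists_characters finX lk(1))
  then obtain \<sigma> where \<sigma>1: "\<forall>p\<in>{..<n} \<times> {..<n}. \<sigma> p \<subseteq> {2..l} \<and> \<sigma> p \<noteq> {}"
    and \<sigma>2: "\<forall>M\<in>\<X>. card {p \<in> {..<n} \<times> {..<n}. pattern l M p = \<sigma> p} < 5 * u"
    by (elim exE conjE)
  have \<sigma>: "\<sigma> (i, j) \<subseteq> {2..l}" "\<sigma> (i, j) \<noteq> {}" if "i < n" "j < n" for i j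
    using bspec[OF \<sigma>1, of "(i, j)"] that by auto
  define P where "P = (\<lambda>(m, m'). m \<triangle> m') ` (\<X> \<times> \<X>)"
  have finP: "finite P" using finX by (simp add: P_def)
  have cP: "card P \<le> card \<X> ^ 2"
    unfolding P_def using card_image_le[of "\<X> \<times> \<X>"] finX by (simp add: card_cartesian_product power2_eq_square)
  define Q where "Q = {i. i < n \<and> ((\<forall>b\<in>{7..k}. \<not> bit i (b - 1)) \<or> (\<forall>b\<in>{1..6}. \<not> bit i (b - 1)))}"
  \<comment> \<open>An element outside \<open>Q\<close> has a nonzero bit among the first six and another one among the remaining
    ones, so whichever of these two groups of bits of \<open>y\<^sub>j\<close> is split, \<open>y\<^sub>j\<close> cannot point to it.\<close>
  have Qn: "Q \<subseteq> {..<n}" by (auto simp: Q_def)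
  have "k - 6 = (k - 8) + 2" using n(2) by linarith
  then have "2 ^ (k - 6) = 4 * u" by (simp add: u(2) power_add)
  then have cQ: "card Q \<le> 8 * u"
    using card_aligned[OF n(1)] n(2) u16 by (simp add: Q_def)
  \<comment> \<open>The factor 5 gives \<open>(3 / 4) ^ 5 \<le> 1 / 4\<close>, so the failure
    probability is of order \<open>(1 / 4) ^ u\<close> against at most \<open>2 ^ u\<close>
    quotients.\<close>
  have "real (card P) * (2 / 2 ^ (5 * u) + (3 / 4) ^ (5 * u)) < 1 / 2"
  proof -
    have "real (card P) \<le> 2 ^ u"
      using cP X2 by (metis le_less_trans less_imp_le of_nat_le_iff of_nat_numeral of_nat_power)
    moreover have "2 / 2 ^ (5 * u) + (3 / 4) ^ (5 * u) \<le> 3 * (1 / 4 :: real) ^ u"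
    proof -
      have "(3 / 4 :: real) ^ (5 * u) \<le> (1 / 4) ^ u"
        unfolding power_mult by (rule power_mono) (simp_all add: power_divide)
      moreover have "(1 / 2 :: real) ^ (5 * u) \<le> (1 / 4) ^ u"
        unfolding power_mult by (rule power_mono) (simp_all add: power_divide)
      ultimately show ?thesis by (simp add: power_one_over)
    qed
    ultimately have "real (card P) * (2 / 2 ^ (5 * u) + (3 / 4) ^ (5 * u)) \<le> 2 ^ u * (3 * (1 / 4) ^ u)"
      by (intro mult_mono) auto
    also have "\<dots> = 3 * (1 / 2) ^ u"
      by (simp add: power_mult_distrib[symmetric] mult.left_commute)
    also have "\<dots> \<le> 3 * (1 / 2) ^ 16"
      using u16 by (intro mult_left_mono power_decreasing) auto
    also have "\<dots> < 1 / 2" by (simp add: power_divide)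
    finally show ?thesis .
  qed
  from exists_split[OF finP this Qn, of l k] obtain U W where UW: "U \<subseteq> {..<n}" "n \<le> 2 * card U"
    and good: "\<forall>M\<in>P.
     (\<forall>r\<in>{int, \<lambda>j. - int j}. followers r (arrow l M) Q {..<n} U \<subseteq> Q \<union> U \<longrightarrow>
        card (followers r (arrow l M) Q {..<n} U - Q) < 5 * u) \<and>
     (card (pointing n k M - Q) < 5 * u \<or>
        (\<exists>j\<in>pointing n k M - Q. j \<notin> U \<and> (j \<in> W) = (\<exists>b\<in>{1..6}. Y j b \<in> M)))"
    by (elim exE conjE)
  have fol: "card (followers r (arrow l M) Q {..<n} U - Q) < 5 * u"
    if "M \<in> P" "r \<in> {int, \<lambda>j. - int j}" "followers r (arrow l M) Q {..<n} U \<subseteq> Q \<union> U" for M r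
    using bspec[OF conjunct1[OF bspec[OF good that(1)]] that(2)] that(3) by (rule mp)
  have poi: "card (pointing n k M - Q) < 5 * u \<or>
        (\<exists>j\<in>pointing n k M - Q. j \<notin> U \<and> (j \<in> W) = (\<exists>b\<in>{1..6}. Y j b \<in> M))" if "M \<in> P" for M
    by (rule conjunct2[OF bspec[OF good that]])
  define S where "S = Q \<union> U"
  define B where "B j = (if j \<in> W then {1..6} else {7..k})" for j
  have SN: "S \<subseteq> {..<n}" using Qn UW by (auto simp: S_def)
  have "\<exists>b\<in>{1..k} - B j. bit i (b - 1)" if "i < n" "i \<notin> S" for i j
  proof -
    have "(\<exists>b\<in>{7..k}. bit i (b - 1)) \<and> (\<exists>b\<in>{1..6}. bit i (b - 1))"
      using that by (auto simp: S_def Q_def)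
    moreover have "{7..k} \<subseteq> {1..k} - {1..6}" "{1..6} \<subseteq> {1..k} - {7..k}" using n(2) by auto
    ultimately show ?thesis unfolding B_def by (auto 0 3)
  qed
  then interpret bop_split n k l S B
    by unfold_locales (use n SN in \<open>auto simp: B_def\<close>)
  have "card U \<le> card S" using finS by (auto simp: S_def intro!: card_mono)
  then have cS: "128 * u \<le> card S" using UW u by simp
  show False
  proof (rule no_bop_refutation[OF two lk(1) R, where \<X> = \<X> and e = "5 * u" and h = "card Q + 15 * u"
        and \<sigma> = "\<lambda>i j. if i < n \<and> j < n then X i j ` \<sigma> (i, j) else {}"])
    show "(if i < n \<and> j < n then X i j ` \<sigma> (i, j) else {}) \<subseteq> Bl i j" for i j
      using \<sigma>(1)[of i j] by (auto simp: Bl_def)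
    show "(if i < n \<and> j < n then X i j ` \<sigma> (i, j) else {}) \<noteq> {}" if "i \<in> S" "j \<in> S" for i j
      using \<sigma>(2)[of i j] that SN by auto
    show "M \<in> \<X>" if "p \<in> set R" "mcoeff p M \<noteq> 0" for p M
      using that by (auto simp: \<X>_def)
    show "M \<subseteq> bop_vars l n" if "M \<in> \<X>" for M by (rule XV[OF that])
    show "3 * (5 * u) + 2 * (card Q + 15 * u) + 4 < card S"
    proof -
      have "3 * (5 * u) + 2 * (card Q + 15 * u) + 4 \<le> 61 * u + 4" using cQ by simp
      also have "\<dots> < 128 * u" using u16 by simp
      finally show ?thesis using cS by simp
    qed
  next
    fix m assume m: "m \<in> \<X>"
    let ?\<sigma> = "\<lambda>i j. if i < n \<and> j < n then X i j ` \<sigma> (i, j) else {}"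
    have "tails ?\<sigma> m \<subseteq> fst ` {p \<in> {..<n} \<times> {..<n}. pattern l m p = \<sigma> p}"
    proof
      fix i assume "i \<in> tails ?\<sigma> m"
      then obtain j where j: "i \<in> S" "j \<in> S" "m \<inter> Bl i j = ?\<sigma> i j" by (auto simp: tails_def)
      then have ij: "i < n" "j < n" using SN by auto
      have "m \<inter> Bl i j = X i j ` pattern l m (i, j)" by (auto simp: Bl_def pattern_def)
      then have "X i j ` pattern l m (i, j) = X i j ` \<sigma> (i, j)" using j ij by simp
      then have "pattern l m (i, j) = \<sigma> (i, j)" by (simp add: inj_image_eq_iff inj_def)
      then show "i \<in> fst ` {p \<in> {..<n} \<times> {..<n}. pattern l m p = \<sigma> p}" using ij by force
    qed
    then have "card (tails ?\<sigma> m) \<le> card (fst ` {p \<in> {..<n} \<times> {..<n}. pattern l m p = \<sigma> p})"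
      by (intro card_mono) auto
    also have "\<dots> \<le> card {p \<in> {..<n} \<times> {..<n}. pattern l m p = \<sigma> p}"
      by (rule card_image_le) auto
    finally show "card (tails ?\<sigma> m) \<le> 5 * u" using bspec[OF \<sigma>2 m] by simp
  next
    fix m m' assume mm: "m \<in> \<X>" "m' \<in> \<X>" "(m \<triangle> m') \<inter> T = {}"
    define M where "M = m \<triangle> m'"
    have MP: "M \<in> P" using mm by (auto simp: P_def M_def)
    have MT: "x \<notin> T" if "x \<in> M" for x using mm(3) that by (auto simp: M_def)
    let ?f = "\<lambda>r. followers r (arrow l M) Q {..<n} U"
    \<comment> \<open>An arrow from \<open>S\<close> to the outside would be a split variable in
      \<open>M\<close>.\<close>
    have closed: "?f r \<subseteq> Q \<union> U" for r
    proof
      fix j assume "j \<in> ?f r"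
      then obtain i where i: "j < n" "i \<in> S" "arrow l M i j" by (auto simp: followers_def S_def)
      then obtain q where "q \<in> {2..l}" "X i j q \<in> M" by (auto simp: arrow_def pattern_def)
      then have "j \<in> S" using MT[of "X i j q"] i by (auto simp: T_def)
      then show "j \<in> Q \<union> U" by (simp add: S_def)
    qed
    have p: "card (pointing n k M - Q) < 5 * u"
    proof (rule ccontr)
      assume "\<not> ?thesis"
      then obtain j where j: "j < n" "j \<notin> S" "\<exists>b\<in>{1..k}. Y j b \<in> M" "(j \<in> W) = (\<exists>b\<in>{1..6}. Y j b \<in> M)"
        using poi[OF MP] by (auto simp: pointing_def S_def)
      \<comment> \<open>Either a low bit occurs and the low group is split, or only high bits occur
        and the high group is split; in both cases \<open>M\<close> would contain a split
        variable.\<close>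
      have "\<exists>b\<in>B j. Y j b \<in> M"
      proof (cases "j \<in> W")
        case True
        then show ?thesis using j(4) by (simp add: B_def)
      next
        case False
        obtain b where b: "b \<in> {1..k}" "Y j b \<in> M" using j(3) by blast
        then have "b \<notin> {1..6}" using j(4) False by blast
        then have "b \<in> {7..k}" using b(1) by simp
        then show ?thesis using b(2) False by (auto simp: B_def)
      qed
      then obtain b where "b \<in> B j" "Y j b \<in> M" by blast
      then show False using MT[of "Y j b"] j by (auto simp: T_def)
    qed
    \<comment> \<open>A head outside \<open>Q\<close> that comes from a block has an arrow from a
      kept element with a smaller or a larger number, hence is a follower in one of the two
      orders.\<close>
    have "heads M \<subseteq> Q \<union> (?f int - Q) \<union> (?f (\<lambda>j. - int j) - Q) \<union> (pointing n k M - Q)"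
    proof
      fix j assume "j \<in> heads M"
      then obtain v where v: "j \<in> S" "v \<in> M" "v \<in> Hd j" by (auto simp: heads_def)
      show "j \<in> Q \<union> (?f int - Q) \<union> (?f (\<lambda>j. - int j) - Q) \<union> (pointing n k M - Q)"
      proof (cases v)
        case (X i j' q)
        then have i: "j' = j" "i \<in> S" "i \<noteq> j" "q \<in> {2..l}" using v by (auto simp: Hd_def)
        then have "arrow l M i j" using v X by (auto simp: arrow_def pattern_def)
        moreover have "int i < int j \<or> - int i < - int j" using i by auto
        ultimately have "j \<in> ?f int \<or> j \<in> ?f (\<lambda>j. - int j)"
          using i v SN by (auto simp: followers_def S_def)
        then show ?thesis by auto
      next
        case (Y j' b)
        then have "j' = j" "b \<in> {1..k}" using v by (auto simp: Hd_def)
        then show ?thesis using v Y SN by (auto simp: pointing_def)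
      qed
    qed
    moreover have fin: "finite Q" "finite (?f r)" "finite (pointing n k M)" for r
      using Qn finite_subset by (auto simp: followers_def pointing_def)
    ultimately have "card (heads M) \<le> card (Q \<union> (?f int - Q) \<union> (?f (\<lambda>j. - int j) - Q) \<union> (pointing n k M - Q))"
      by (intro card_mono) auto
    also have "\<dots> \<le> card Q + card (?f int - Q) + card (?f (\<lambda>j. - int j) - Q) + card (pointing n k M - Q)"
      by (meson card_Un_le order_trans add_mono le_refl)
    also have "\<dots> \<le> card Q + 15 * u"
      using p fol[OF MP _ closed, of int] fol[OF MP _ closed, of "\<lambda>j. - int j"] by simp
    finally show "card (heads (m \<triangle> m')) \<le> card Q + 15 * u" by (simp add: M_def)
  qed
qed

theorem theorem3:
  assumes "CHAR('f::field) \<noteq> 2"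
  shows "\<exists>c::real. c > 0 \<and>
    (\<forall>(n::nat) (l::nat) (R :: (bop_var, 'f) mpoly list).
       n > 0 \<and> (\<exists>k. n = 2 ^ k) \<and> real l > 10 * log 2 (real n) \<and>
       pc_refutation (bop_vars l n) (clause_poly ` BOP_or l n) R
       \<longrightarrow> real (pc_size R) \<ge> 2 powr (c * real n))"
\<comment> \<open>For \<open>k < 12\<close> the claimed bound is at most 2, which
  \<open>pc_size_ge_2\<close> provides. For \<open>12 \<le> k\<close> the exponent
  \<open>n / 512\<close> from \<open>size_bound\<close> is more than enough.\<close>
proof (intro exI[of _ "1 / 4096"] conjI allI impI)
  fix n l :: nat and R :: "(bop_var, 'f) mpoly list"
  assume a: "n > 0 \<and> (\<exists>k. n = 2 ^ k) \<and> real l > 10 * log 2 (real n) \<and>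
       pc_refutation (bop_vars l n) (clause_poly ` BOP_or l n) R"
  then obtain k where k: "n = 2 ^ k" by auto
  have l: "10 * k < l" using a by (simp add: k log_nat_power)
  have R: "pc_refutation (bop_vars l n) (clause_poly ` BOP_or l n) R" using a by simp
  \<comment> \<open>If 2 were zero, \<open>CHAR('f)\<close> would divide the prime 2 and so be 1 or
    2.\<close>
  have "CHAR('f) \<noteq> 1" by simp
  then have two: "(2 :: 'f) \<noteq> 0"
    using of_nat_eq_0_iff_char_dvd[of 2, where 'a = 'f] assms prime_nat_iff[of 2] two_is_prime_nat by auto
  show "real (pc_size R) \<ge> 2 powr (1 / 4096 * real n)"
  proof (cases "12 \<le> k")
    case True
    have u: "n = 256 * (n div 256)"
      using k True power_add[of "2::nat" "k - 8" 8] by simp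
    have "2 ^ (n div 256) \<le> (pc_size R) ^ 2" by (rule size_bound[OF two k True l R])
    then have "real (2 ^ (n div 256)) \<le> real ((pc_size R) ^ 2)" by (simp only: of_nat_le_iff)
    then have "2 powr real (n div 256) \<le> real (pc_size R) ^ 2" by (simp add: powr_realpow)
    moreover have "(2 powr (1 / 4096 * real n)) ^ 2 = 2 powr (1 / 2048 * real n)"
      by (simp add: powr_power)
    moreover have "2 powr (1 / 2048 * real n) \<le> 2 powr real (n div 256)"
    proof (rule powr_mono)
      have "real n = 256 * real (n div 256)" using u by (metis of_nat_mult of_nat_numeral)
      then show "1 / 2048 * real n \<le> real (n div 256)" by simp
    qed simp
    ultimately have "(2 powr (1 / 4096 * real n)) ^ 2 \<le> real (pc_size R) ^ 2" by linarith
    then show ?thesis by (rule power2_le_imp_le) simp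
  next
    case False
    then have "n \<le> 4096"
      using power_increasing[of k 12 "2::nat"] k by simp
    then have "2 powr (1 / 4096 * real n) \<le> 2 powr 1" by (intro powr_mono) auto
    moreover have "pc_size R \<ge> 2"
    proof (rule pc_size_ge_2[OF R])
      fix C assume C: "C \<in> BOP_or l n"
      have "finite (or_clause l i j)" "or_clause l i j \<noteq> {}" for i j
        using l by (auto simp: or_clause_def Setcompr_eq_image)
      moreover have "finite (neq_clause n j i)" for i j
        by (simp add: neq_clause_def Setcompr_eq_image)
      ultimately show "finite C \<and> C \<noteq> {}"
        using C unfolding BOP_or_def by auto
    qed
    ultimately show ?thesis by simp
  qed
qed simp

end
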